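(* Let $\alpha=0$, $(\bar u,\bar\mu)\in\mathcal{D}$ and $0<\Delta x\le1$. For $t\in[0,\infty)$ let $(y,U,V)(t)=S_t\circ L((\bar u,\bar\mu))$ and $(y_{\Delta x},U_{\Delta x},V_{\Delta x})(t)=S_t\circ L\circ P_{\Delta x}((\bar u,\bar\mu))$. Then $$\|U(t)-U_{\Delta x}(t)\|_\infty\le(1+2\sqrt2)\,\bar F_{\mathrm{ac},\infty}^{1/2}\Delta x^{1/2}+t\Delta x,$$ $$\|y(t)-y_{\Delta x}(t)\|_\infty\le(1+2\sqrt2)\,\bar F_{\mathrm{ac},\infty}^{1/2}\,t\,\Delta x^{1/2}+\bigl(2+\tfrac12t^2\bigr)\Delta x.$$ Furthermore, let $(u,\mu)(t)=T_t((\bar u,\bar\mu))$ and $(u_{\Delta x},\mu_{\Delta x})(t)=T_t\circ P_{\Delta x}((\bar u,\bar\mu))$. Then $$\|u(t)-u_{\Delta x}(t)\|_\infty\le\sqrt{1+2\sqrt2}\;\bar F_\infty^{3/4}t^{1/2}\Delta x^{1/4}+\Bigl(1+2\sqrt2+\sqrt{2+\tfrac12t^2}\Bigr)\bar F_\infty^{1/2}\Delta x^{1/2}+t\Delta x.$$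
   Context: Norms: $\|\cdot\|_p$ is the $L^p(\mathbb{R})$ norm. Eulerian set $\mathcal{D}$. Let $\chi^\pm\in C^\infty(\mathbb{R})$ satisfy $\chi^++\chi^-=1$, $0\le\chi^\pm\le1$, $\mathrm{supp}\,\chi^+\subset(-1,\infty)$, $\mathrm{supp}\,\chi^-\subset(-\infty,1)$. Let $E_2=\{\bar f+a\chi^++b\chi^-:\bar f\in H^1(\mathbb{R}),a,b\in\mathbb{R}\}$ and $E_1^0=\{\bar f+a\chi^+:\bar f\in L^2(\mathbb{R}),a\in\mathbb{R}\}$ (independent of the choice of $\chi^\pm$). $\mathcal{D}$ is the set of pairs $(u,\mu)$ such that $u\in E_2$, $\mu$ is a nonnegative finite Radon measure on $\mathbb{R}$, $\mu((-\infty,\cdot))\in E_1^0$, and $d\mu_{\mathrm{ac}}=u_x^2\,dx$, where $\mu=\mu_{\mathrm{ac}}+\mu_{\mathrm{sing}}$ is the Lebesgue decomposition. Write $F(x)=\mu((-\infty,x))$, $F_{\mathrm{ac}}(x)=\mu_{\mathrm{ac}}((-\infty,x))$, $F_{\mathrm{sing}}(x)=\mu_{\mathrm{sing}}((-\infty,x))$, $F_\infty=\mu(\mathbb{R})$, $F_{\mathrm{ac},\infty}=\mu_{\mathrm{ac}}(\mathbb{R})$; $(u,\mu)$ and $(u,F)$ are used interchangeably. Bars denote initial data. Map $L$: $(\bar y,\bar U,\bar V)=L((\bar u,\bar\mu))$ with $\bar y(\xi)=\sup\{x\in\mathbb{R}: x+\bar\mu((-\infty,x))<\xi\}$, $\bar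 U(\xi)=\bar u(\bar y(\xi))$, $\bar V(\xi)=\xi-\bar y(\xi)$. Solution operator $S_t$ in the case $\alpha=0$ (conservative solutions): for $\bar X=(\bar y,\bar U,\bar V)$ in the image of $L$, $S_t(\bar X)=(y,U,V)(t)$ is the unique solution with initial data $\bar X$ of $y_t(t,\xi)=U(t,\xi)$, $U_t(t,\xi)=\tfrac12V(t,\xi)-\tfrac14V_\infty(t)$, $V(t,\xi)=\int_{-\infty}^\xi\bar V_\xi(\eta)\,d\eta=\bar V(\xi)$, with $V_\infty(t)=\lim_{\xi\to\infty}V(t,\xi)$. Map $M$: $(u,\mu)=M((y,U,V))$ with $u(x)=U(\xi)$ for any $\xi$ with $x=y(\xi)$, and $\mu=y_\#(V_\xi\,d\xi)$ (pushforward). The solution operator is $T_t=M\circ S_t\circ L$. Projection $P_{\Delta x}:\mathcal{D}\to\mathcal{D}$: for $\Delta x>0$ let $x_j=j\Delta x$, $j\in\mathbb{Z}$, $f_j=f(x_j)$, $Df_{2j}=(f_{2j+2}-f_{2j})/(2\Delta x)$, $q_{2j}=\sqrt{DF_{\mathrm{ac},2j}-(Du_{2j})^2}$. Then $P_{\Delta x}((u,F))=(u_{\Delta x},F_{\Delta x})$, $F_{\Delta x}=F_{\Delta x,\mathrm{ac}}+F_{\Delta x,\mathrm{sing}}$, where for each $j$ (with either the upper or the lower signs chosen, consistently within $(x_{2j},x_{2j+2}]$; the choice is arbitrary): on $(x_{2j},x_{2j+1}]$: $u_{\Delta x}(x)=u_{2j}+(Du_{2j}\mp q_{2j})(x-x_{2j})$,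 $F_{\Delta x,\mathrm{ac}}(x)=F_{\mathrm{ac},2j}+(Du_{2j}\mp q_{2j})^2(x-x_{2j})$; on $(x_{2j+1},x_{2j+2}]$: $u_{\Delta x}(x)=u_{2j+2}+(Du_{2j}\pm q_{2j})(x-x_{2j+2})$, $F_{\Delta x,\mathrm{ac}}(x)=\tfrac12(F_{\mathrm{ac},2j+2}+F_{\mathrm{ac},2j})\mp2q_{2j}Du_{2j}\Delta x+(Du_{2j}\pm q_{2j})^2(x-x_{2j+1})$; on $(x_{2j},x_{2j+2}]$: $F_{\Delta x,\mathrm{sing}}(x)=F_{\mathrm{sing},2j+2}$. *)

theory Defs
  imports "HOL-Analysis.Analysis" "HOL-Probability.Essential_Supremum"
begin

subsection \<open>Function spaces on the real line\<close>

definition smooth :: "(real \<Rightarrow> real) \<Rightarrow> bool" where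
  "smooth f \<longleftrightarrow> (\<forall>n x. ((deriv ^^ n) f) differentiable (at x))"

definition supp :: "(real \<Rightarrow> real) \<Rightarrow> real set" where
  "supp f = closure {x. f x \<noteq> 0}"

definition test_function :: "(real \<Rightarrow> real) \<Rightarrow> bool" where
  "test_function \<phi> \<longleftrightarrow> smooth \<phi> \<and> compact (supp \<phi>)"

definition L2_fun :: "(real \<Rightarrow> real) set" where
  "L2_fun = {f. f \<in> borel_measurable borel \<and> integrable lborel (\<lambda>x. (f x)\<^sup>2)}"

definition locally_integrable :: "(real \<Rightarrow> real) \<Rightarrow> bool" where
  "locally_integrable f \<longleftrightarrow>
     f \<in> borel_measurable borel \<and> (\<forall>a b. set_integrable lborel {a..b} f)"

definition weak_deriv :: "(real \<Rightarrow> real) \<Rightarrow> (real \<Rightarrow> real) \<Rightarrow> bool" where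
  "weak_deriv f g \<longleftrightarrow> locally_integrable f \<and> locally_integrable g \<and>
     (\<forall>\<phi>. test_function \<phi> \<longrightarrow>
        (LINT x|lborel. f x * deriv \<phi> x) = - (LINT x|lborel. g x * \<phi> x))"

text \<open>Elements of \<open>H\<^sup>1(\<real>)\<close> are identified with their continuous representatives, since
  they are evaluated pointwise below.\<close>
definition H1_fun :: "(real \<Rightarrow> real) set" where
  "H1_fun = {f. continuous_on UNIV f \<and> f \<in> L2_fun \<and> (\<exists>g\<in>L2_fun. weak_deriv f g)}"

definition Linf_norm :: "(real \<Rightarrow> real) \<Rightarrow> ereal" where
  "Linf_norm f = esssup lborel (\<lambda>x. ereal \<bar>f x\<bar>)"


subsection \<open>Eulerian coordinates\<close>

definition cutoff_pair :: "(real \<Rightarrow> real) \<Rightarrow> (real \<Rightarrow> real) \<Rightarrow> bool" where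
  "cutoff_pair \<chi>p \<chi>m \<longleftrightarrow> smooth \<chi>p \<and> smooth \<chi>m \<and>
     (\<forall>x. \<chi>p x + \<chi>m x = 1 \<and> 0 \<le> \<chi>p x \<and> \<chi>p x \<le> 1 \<and> 0 \<le> \<chi>m x \<and> \<chi>m x \<le> 1) \<and>
     supp \<chi>p \<subseteq> {-1<..} \<and> supp \<chi>m \<subseteq> {..<1}"

definition E2 :: "(real \<Rightarrow> real) \<Rightarrow> (real \<Rightarrow> real) \<Rightarrow> (real \<Rightarrow> real) set" where
  "E2 \<chi>p \<chi>m = {\<lambda>x. f x + a * \<chi>p x + b * \<chi>m x | f a b. f \<in> H1_fun}"

definition E10 :: "(real \<Rightarrow> real) \<Rightarrow> (real \<Rightarrow> real) set" where
  "E10 \<chi>p = {\<lambda>x. f x + a * \<chi>p x | f a. f \<in> L2_fun}"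

definition lebesgue_decomposition :: "real measure \<Rightarrow> real measure \<Rightarrow> real measure \<Rightarrow> bool" where
  "lebesgue_decomposition \<mu> \<nu> \<sigma> \<longleftrightarrow>
     sets \<nu> = sets borel \<and> sets \<sigma> = sets borel \<and>
     absolutely_continuous lborel \<nu> \<and>
     (\<exists>N\<in>null_sets lborel. emeasure \<sigma> (- N) = 0) \<and>
     (\<forall>A\<in>sets borel. emeasure \<mu> A = emeasure \<nu> A + emeasure \<sigma> A)"

definition ac_part :: "real measure \<Rightarrow> real measure" where
  "ac_part \<mu> = (THE \<nu>. \<exists>\<sigma>. lebesgue_decomposition \<mu> \<nu> \<sigma>)"

definition sing_part :: "real measure \<Rightarrow> real measure" where
  "sing_part \<mu> = (THE \<sigma>. \<exists>\<nu>. lebesgue_decomposition \<mu> \<nu> \<sigma>)"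

text \<open>The left-continuous distribution function; \<open>cdf\<close> of \<open>HOL-Probability\<close> is the
  right-continuous one.\<close>
definition lcdf :: "real measure \<Rightarrow> real \<Rightarrow> real" where
  "lcdf \<mu> x = measure \<mu> {..<x}"

definition measure_of_lcdf :: "(real \<Rightarrow> real) \<Rightarrow> real measure" where
  "measure_of_lcdf F = (THE \<mu>. sets \<mu> = sets borel \<and> finite_measure \<mu> \<and> lcdf \<mu> = F)"

text \<open>On the real line every finite Borel measure is a Radon measure.\<close>
definition Eulerian ::
    "(real \<Rightarrow> real) \<Rightarrow> (real \<Rightarrow> real) \<Rightarrow> ((real \<Rightarrow> real) \<times> real measure) set" where
  "Eulerian \<chi>p \<chi>m = {(u, \<mu>).
     u \<in> E2 \<chi>p \<chi>m \<and>
     sets \<mu> = sets borel \<and> finite_measure \<mu> \<and>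
     lcdf \<mu> \<in> E10 \<chi>p \<and>
     (\<exists>ux. weak_deriv u ux \<and> ac_part \<mu> = density lborel (\<lambda>x. ennreal ((ux x)\<^sup>2)))}"


subsection \<open>Lagrangian coordinates and conservative solutions\<close>

type_synonym lagrangian = "(real \<Rightarrow> real) \<times> (real \<Rightarrow> real) \<times> (real \<Rightarrow> real)"

definition L_map :: "(real \<Rightarrow> real) \<times> real measure \<Rightarrow> lagrangian" where
  "L_map = (\<lambda>(u, \<mu>).
     let y = (\<lambda>\<xi>. Sup {x. x + lcdf \<mu> x < \<xi>})
     in (y, \<lambda>\<xi>. u (y \<xi>), \<lambda>\<xi>. \<xi> - y \<xi>))"

text \<open>The arguments \<open>y U V\<close> are functions of time and label; only times \<open>t \<ge> 0\<close> matter,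
  and the time derivatives at \<open>0\<close> are one-sided.  For \<open>\<alpha> = 0\<close> no energy is dissipated and
  \<open>V\<close> keeps its initial value.\<close>
definition lagrangian_solution ::
    "lagrangian \<Rightarrow> (real \<Rightarrow> real \<Rightarrow> real) \<Rightarrow> (real \<Rightarrow> real \<Rightarrow> real) \<Rightarrow> (real \<Rightarrow> real \<Rightarrow> real) \<Rightarrow> bool"
  where
  "lagrangian_solution X0 y U V \<longleftrightarrow>
     (y 0, U 0, V 0) = X0 \<and>
     (\<forall>t\<ge>0. \<forall>\<xi>.
        ((\<lambda>s. y s \<xi>) has_real_derivative U t \<xi>) (at t within {0..}) \<and>
        ((\<lambda>s. U s \<xi>) has_real_derivative (1/2 * V t \<xi> - 1/4 * Lim at_top (V t)))
           (at t within {0..}) \<and>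
        V t \<xi> = snd (snd X0) \<xi>)"

definition S_op :: "real \<Rightarrow> lagrangian \<Rightarrow> lagrangian" where
  "S_op t X0 = (THE X. \<exists>y U V. lagrangian_solution X0 y U V \<and> X = (y t, U t, V t))"

definition M_map :: "lagrangian \<Rightarrow> (real \<Rightarrow> real) \<times> real measure" where
  "M_map = (\<lambda>(y, U, V).
     (\<lambda>x. THE v. \<exists>\<xi>. x = y \<xi> \<and> v = U \<xi>,
      distr (density lborel (\<lambda>\<xi>. ennreal (deriv V \<xi>))) borel y))"

definition T_op :: "real \<Rightarrow> (real \<Rightarrow> real) \<times> real measure \<Rightarrow> (real \<Rightarrow> real) \<times> real measure" where
  "T_op t = M_map \<circ> S_op t \<circ> L_map"


subsection \<open>The projection operator\<close>

definition node :: "real \<Rightarrow> int \<Rightarrow> real" where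
  "node h j = of_int j * h"

definition D_even :: "real \<Rightarrow> (real \<Rightarrow> real) \<Rightarrow> int \<Rightarrow> real" where
  "D_even h f j = (f (node h (2*j+2)) - f (node h (2*j))) / (2*h)"

definition q_even :: "real \<Rightarrow> (real \<Rightarrow> real) \<Rightarrow> (real \<Rightarrow> real) \<Rightarrow> int \<Rightarrow> real" where
  "q_even h u Fac j = sqrt (D_even h Fac j - (D_even h u j)\<^sup>2)"

text \<open>The unique \<open>j\<close> with \<open>node h (2*j) < x \<le> node h (2*j+2)\<close>.\<close>
definition cell :: "real \<Rightarrow> real \<Rightarrow> int" where
  "cell h x = \<lceil>x / (2*h)\<rceil> - 1"

text \<open>In the next three definitions \<open>s j = 1\<close> selects the upper and \<open>s j = -1\<close> the lower signs
  on the cell with index \<open>j\<close>.\<close>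
definition proj_u ::
    "(int \<Rightarrow> real) \<Rightarrow> real \<Rightarrow> (real \<Rightarrow> real) \<Rightarrow> (real \<Rightarrow> real) \<Rightarrow> real \<Rightarrow> real" where
  "proj_u s h u Fac x =
     (let j = cell h x; Du = D_even h u j; q = q_even h u Fac j in
      if x \<le> node h (2*j+1)
      then u (node h (2*j)) + (Du - s j * q) * (x - node h (2*j))
      else u (node h (2*j+2)) + (Du + s j * q) * (x - node h (2*j+2)))"

definition proj_Fac ::
    "(int \<Rightarrow> real) \<Rightarrow> real \<Rightarrow> (real \<Rightarrow> real) \<Rightarrow> (real \<Rightarrow> real) \<Rightarrow> real \<Rightarrow> real" where
  "proj_Fac s h u Fac x =
     (let j = cell h x; Du = D_even h u j; q = q_even h u Fac j in
      if x \<le> node h (2*j+1)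
      then Fac (node h (2*j)) + (Du - s j * q)\<^sup>2 * (x - node h (2*j))
      else 1/2 * (Fac (node h (2*j+2)) + Fac (node h (2*j))) - s j * (2 * q * Du * h)
           + (Du + s j * q)\<^sup>2 * (x - node h (2*j+1)))"

definition proj_Fsing :: "real \<Rightarrow> (real \<Rightarrow> real) \<Rightarrow> real \<Rightarrow> real" where
  "proj_Fsing h Fsing x = Fsing (node h (2 * cell h x + 2))"

definition P_op :: "(int \<Rightarrow> real) \<Rightarrow> real \<Rightarrow>
    (real \<Rightarrow> real) \<times> real measure \<Rightarrow> (real \<Rightarrow> real) \<times> real measure" where
  "P_op s h = (\<lambda>(u, \<mu>).
     let Fac = lcdf (ac_part \<mu>); Fsing = lcdf (sing_part \<mu>)
     in (proj_u s h u Fac,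
         measure_of_lcdf (\<lambda>x. proj_Fac s h u Fac x + proj_Fsing h Fsing x)))"

end

theory Submission
  imports Defs "HOL-Probability.Distribution_Functions"
begin

text \<open>By Cauchy-Schwarz, \<open>(u(b) - u(a))\<^sup>2 \<le> (b - a) (F\<^sub>a\<^sub>c(b) - F\<^sub>a\<^sub>c(a))\<close>. The projected data satisfy the
  same inequality, and \<open>F\<close> is unchanged at the even nodes. Hence the two initial characteristics of
  a label lie in a common closed cell of width \<open>2\<Delta>x\<close>, and the two initial velocities differ by
  \<open>O(\<Delta>x\<^sup>1\<^sup>/\<^sup>2)\<close>. For \<open>\<alpha> = 0\<close> the solution is an explicit quadratic in time, which propagates both
  bounds. In Lagrangian coordinates the inequality reads
  \<open>(\<delta>U)\<^sup>2 \<le> \<delta>y \<delta>V\<close> for increments between two labels, and the flow preserves it. So \<open>u(t)\<close> is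
  Hoelder continuous with exponent \<open>1/2\<close>, and this turns the bound on \<open>y\<close> into the one on \<open>u\<close>.\<close>

section \<open>Lebesgue decomposition and distribution functions\<close>

text \<open>\<open>ac_part\<close>, \<open>measure_of_lcdf\<close>, \<open>S_op\<close> and the
  velocity in \<open>M_map\<close> are definite descriptions, so existence and uniqueness have to be
  settled for each before anything can be estimated. The obstacle in the estimates is the singular
  energy: \<open>F\<close> may jump, so \<open>y0\<close> is only a generalised inverse of
  \<open>x + F x\<close>, and increments of \<open>V\<close> dominate those of the continuous part
  \<open>A\<close>, but not those of \<open>F\<close>. The locale \<open>energy_pair\<close> retains
  just the facts that the original and the projected data share; it is interpreted a second time for
  the projected pair, and both solutions are handled by one development. The projection also
  preserves the total mass \<open>K\<close>, so the terms with \<open>K / 4\<close> cancel in every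
  difference. As for the constant, the displacement \<open>2 * h\<close> of the characteristics
  contributes \<open>sqrt 2\<close>, the distance from \<open>u\<close> to its projection
  contributes \<open>2\<close>, and \<open>sqrt 2 + 2 \<le> 1 + 2 * sqrt 2\<close>.\<close>

lemma lebesgue_decomposition_unique:
  assumes "lebesgue_decomposition \<mu> \<nu> \<sigma>" and "lebesgue_decomposition \<mu> \<nu>' \<sigma>'"
  shows "\<nu> = \<nu>'" and "\<sigma> = \<sigma>'"
proof -
  obtain N where N: "N \<in> null_sets lborel" "emeasure \<sigma> (- N) = 0"
    using assms(1) by (auto simp: lebesgue_decomposition_def)
  obtain N' where N': "N' \<in> null_sets lborel" "emeasure \<sigma>' (- N') = 0"
    using assms(2) by (auto simp: lebesgue_decomposition_def)
  \<comment> \<open>Off \<open>Z\<close> both singular parts vanish, and on \<open>Z\<close> both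
    absolutely continuous parts do. Each part is therefore \<open>\<mu>\<close> restricted to a set
    that is the same for both decompositions.\<close>
  define Z where "Z = N \<union> N'"
  have Z: "Z \<in> null_sets lborel" using N N' by (auto simp: Z_def)
  hence Zs: "Z \<in> sets borel" by auto
  have key: "emeasure n A = emeasure \<mu> (A - Z) \<and> emeasure s A = emeasure \<mu> (A \<inter> Z)"
    if d: "lebesgue_decomposition \<mu> n s" and M: "M \<in> null_sets lborel" "emeasure s (- M) = 0"
      "M \<subseteq> Z" and A: "A \<in> sets borel" for n s M A
  proof -
    have s: "sets n = sets borel" "sets s = sets borel" and ac: "absolutely_continuous lborel n"
      and eq: "\<And>A. A \<in> sets borel \<Longrightarrow> emeasure \<mu> A = emeasure n A + emeasure s A"
      using d by (auto simp: lebesgue_decomposition_def)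
    have nZ: "emeasure n Z = 0"
      using ac Z by (auto simp: absolutely_continuous_def null_sets_def)
    have sZ: "emeasure s (A - Z) = 0"
    proof -
      have "emeasure s (A - Z) \<le> emeasure s (- M)"
        using M A s by (intro emeasure_mono) (auto simp: null_sets_def)
      thus ?thesis using M(2) by simp
    qed
    have nAZ: "emeasure n (A \<inter> Z) = 0"
      using nZ emeasure_mono[of "A \<inter> Z" Z n] Zs s by auto
    have split: "emeasure m A = emeasure m (A \<inter> Z) + emeasure m (A - Z)" if "sets m = sets borel" for m
    proof -
      have "A = (A \<inter> Z) \<union> (A - Z)" by auto
      moreover have "emeasure m ((A \<inter> Z) \<union> (A - Z)) = emeasure m (A \<inter> Z) + emeasure m (A - Z)"
        using that A Zs by (intro plus_emeasure[symmetric]) auto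
      ultimately show ?thesis by simp
    qed
    show ?thesis
      using split[OF s(1)] split[OF s(2)] eq[of "A \<inter> Z"] eq[of "A - Z"] A Zs nAZ sZ by auto
  qed
  show "\<nu> = \<nu>'"
    using key[OF assms(1) N] key[OF assms(2) N'] assms
    by (intro measure_eqI) (auto simp: Z_def lebesgue_decomposition_def)
  show "\<sigma> = \<sigma>'"
    using key[OF assms(1) N] key[OF assms(2) N'] assms
    by (intro measure_eqI) (auto simp: Z_def lebesgue_decomposition_def)
qed

text \<open>The singular part lives on a Lebesgue null set of maximal \<open>\<mu>\<close>-measure.\<close>
lemma lebesgue_decomposition_exists:
  assumes sets: "sets \<mu> = sets borel" and fin: "finite_measure \<mu>"
  obtains \<nu> \<sigma> where "lebesgue_decomposition \<mu> \<nu> \<sigma>"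
proof -
  interpret finite_measure \<mu> by fact
  define S where "S = (SUP N\<in>null_sets lborel. measure \<mu> N)"
  have bdd: "bdd_above (measure \<mu> ` null_sets lborel)"
    by (intro bdd_aboveI2[of _ _ "measure \<mu> (space \<mu>)"] bounded_measure)
  have "\<exists>N\<in>null_sets lborel. S - 1 / real (Suc n) < measure \<mu> N" for n
  proof -
    have "S - 1 / real (Suc n) < S" by simp
    thus ?thesis unfolding S_def using bdd by (subst (asm) less_cSUP_iff) auto
  qed
  then obtain N where N: "\<And>n. N n \<in> null_sets lborel" "\<And>n. S - 1 / real (Suc n) < measure \<mu> (N n)"
    by metis
  define Z where "Z = (\<Union>n. N n)"
  have Z: "Z \<in> null_sets lborel" unfolding Z_def using N by blast
  hence Zs: "Z \<in> sets borel" by auto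
  have "S - 1 / real (Suc n) \<le> measure \<mu> Z" for n
  proof -
    have "measure \<mu> (N n) \<le> measure \<mu> Z"
      using Zs sets by (intro finite_measure_mono) (auto simp: Z_def)
    thus ?thesis using N(2)[of n] by linarith
  qed
  moreover have "(\<lambda>n. S - 1 / real (Suc n)) \<longlonglongrightarrow> S"
    using LIMSEQ_inverse_real_of_nat_add_minus[of S] by (simp add: inverse_eq_divide)
  ultimately have SZ: "S \<le> measure \<mu> Z" by (intro LIMSEQ_le_const2) auto
  \<comment> \<open>Otherwise \<open>A \<union> Z\<close> would be a null set whose measure exceeds
    the supremum \<open>S\<close>.\<close>
  have max: "emeasure \<mu> (A - Z) = 0" if A: "A \<in> null_sets lborel" for A
  proof -
    have "measure \<mu> (A \<union> Z) \<le> S"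
      unfolding S_def using A Z bdd by (intro cSUP_upper) auto
    moreover have "measure \<mu> (Z \<union> (A - Z)) = measure \<mu> Z + measure \<mu> (A - Z)"
      using A Zs sets by (intro finite_measure_Union) (auto simp: null_sets_def)
    moreover have "Z \<union> (A - Z) = A \<union> Z" by auto
    ultimately have "measure \<mu> Z + measure \<mu> (A - Z) \<le> S" by simp
    hence "measure \<mu> (A - Z) = 0"
      using SZ measure_nonneg[of \<mu> "A - Z"] by linarith
    thus ?thesis by (simp add: emeasure_eq_measure)
  qed
  have em: "emeasure (density \<mu> (indicator B)) A = emeasure \<mu> (B \<inter> A)"
    if "A \<in> sets borel" "B \<in> sets borel" for A B
    using that sets by (intro emeasure_restricted) auto
  have "lebesgue_decomposition \<mu> (density \<mu> (indicator (- Z))) (density \<mu> (indicator Z))"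
    unfolding lebesgue_decomposition_def
  proof (intro conjI ballI)
    show "absolutely_continuous lborel (density \<mu> (indicator (- Z)))"
      unfolding absolutely_continuous_def
    proof
      fix A :: "real set" assume A: "A \<in> null_sets lborel"
      moreover have "- Z \<inter> A = A - Z" by auto
      ultimately show "A \<in> null_sets (density \<mu> (indicator (- Z)))"
        using max[OF A] em[of A "- Z"] Zs sets by (auto simp: null_sets_def)
    qed
    show "\<exists>N\<in>null_sets lborel. emeasure (density \<mu> (indicator Z)) (- N) = 0"
      using Z Zs em by (intro bexI[of _ Z]) auto
    fix A :: "real set" assume A: "A \<in> sets borel"
    have "emeasure \<mu> ((- Z \<inter> A) \<union> (Z \<inter> A)) = emeasure \<mu> (- Z \<inter> A) + emeasure \<mu> (Z \<inter> A)"
      using A Zs sets by (intro plus_emeasure[symmetric]) auto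
    moreover have "(- Z \<inter> A) \<union> (Z \<inter> A) = A" by auto
    ultimately show "emeasure \<mu> A = emeasure (density \<mu> (indicator (- Z))) A
        + emeasure (density \<mu> (indicator Z)) A"
      using A Zs by (simp add: em)
  qed (use sets in auto)
  thus ?thesis by (rule that)
qed

lemma lebesgue_decomposition_parts:
  assumes "sets \<mu> = sets borel" and "finite_measure \<mu>"
  shows "lebesgue_decomposition \<mu> (ac_part \<mu>) (sing_part \<mu>)"
proof -
  obtain \<nu> \<sigma> where d: "lebesgue_decomposition \<mu> \<nu> \<sigma>"
    using lebesgue_decomposition_exists assms by blast
  have "ac_part \<mu> = \<nu>" "sing_part \<mu> = \<sigma>"
    unfolding ac_part_def sing_part_def
    using d lebesgue_decomposition_unique by (blast intro: the_equality)+
  thus ?thesis using d by simp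
qed

section \<open>Left-continuous distribution functions of finite measures\<close>

lemma finite_borel_measureI:
  assumes "sets \<mu> = sets borel" and "finite_measure \<mu>"
  shows "finite_borel_measure \<mu>"
  using assms by (simp add: finite_borel_measure_def finite_borel_measure_axioms_def)

lemma lcdf_tendsto_at_bot:
  assumes "sets \<mu> = sets borel" and "finite_measure \<mu>"
  shows "(lcdf \<mu> \<longlongrightarrow> 0) at_bot"
proof -
  interpret finite_borel_measure \<mu> by (rule finite_borel_measureI) fact+
  show ?thesis
  proof (rule tendsto_sandwich[OF _ _ tendsto_const cdf_lim_at_bot])
    show "\<forall>\<^sub>F x in at_bot. lcdf \<mu> x \<le> cdf \<mu> x"
      by (auto simp: lcdf_def cdf_def intro!: always_eventually finite_measure_mono)
  qed (auto simp: lcdf_def)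
qed

lemma lcdf_diff:
  assumes "sets \<mu> = sets borel" and "finite_measure \<mu>" and "a \<le> b"
  shows "lcdf \<mu> b - lcdf \<mu> a = measure \<mu> {a..<b}"
proof -
  interpret finite_measure \<mu> by fact
  have "measure \<mu> ({..<a} \<union> {a..<b}) = measure \<mu> {..<a} + measure \<mu> {a..<b}"
    using assms by (intro finite_measure_Union) auto
  moreover have "{..<a} \<union> {a..<b} = {..<b}" using assms(3) by auto
  ultimately show ?thesis by (simp add: lcdf_def)
qed

lemma lcdf_mono:
  assumes "sets \<mu> = sets borel" and "finite_measure \<mu>"
  shows "mono (lcdf \<mu>)"
proof (rule monoI)
  fix a b :: real assume "a \<le> b"
  thus "lcdf \<mu> a \<le> lcdf \<mu> b"
    using lcdf_diff[OF assms, of a b] measure_nonneg[of \<mu> "{a..<b}"] by linarith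
qed

lemma lcdf_bounds:
  assumes "sets \<mu> = sets borel" and "finite_measure \<mu>"
  shows "0 \<le> lcdf \<mu> x" and "lcdf \<mu> x \<le> measure \<mu> UNIV"
proof -
  interpret finite_measure \<mu> by fact
  show "0 \<le> lcdf \<mu> x" by (simp add: lcdf_def)
  have "space \<mu> = UNIV" using assms(1) sets_eq_imp_space_eq by fastforce
  thus "lcdf \<mu> x \<le> measure \<mu> UNIV" using bounded_measure[of "{..<x}"] by (simp add: lcdf_def)
qed

lemma lcdf_tendsto_at_top:
  assumes "sets \<mu> = sets borel" and "finite_measure \<mu>"
  shows "(lcdf \<mu> \<longlongrightarrow> measure \<mu> UNIV) at_top"
proof -
  interpret finite_borel_measure \<mu> by (rule finite_borel_measureI) fact+
  note sp = borel_UNIV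
  \<comment> \<open>The shift by one puts the closed half-line of \<open>cdf\<close> inside the open
    one of \<open>lcdf\<close>.\<close>
  have "((\<lambda>x. cdf \<mu> (-1 + x)) \<longlongrightarrow> measure \<mu> UNIV) at_top"
    using filterlim_compose[OF cdf_lim_at_top
        filterlim_tendsto_add_at_top[OF tendsto_const[of "-1"] filterlim_ident]]
    by (simp add: sp)
  thus ?thesis
  proof (rule tendsto_sandwich[OF _ _ _ tendsto_const, rotated 2])
    show "\<forall>\<^sub>F x in at_top. cdf \<mu> (-1 + x) \<le> lcdf \<mu> x"
      by (auto simp: lcdf_def cdf_def intro!: always_eventually finite_measure_mono)
  qed (use lcdf_bounds[OF assms] in \<open>auto intro: always_eventually\<close>)
qed

lemma lcdf_tendsto_at_left:
  assumes "sets \<mu> = sets borel" and "finite_measure \<mu>"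
  shows "(lcdf \<mu> \<longlongrightarrow> lcdf \<mu> x) (at_left x)"
proof -
  interpret finite_borel_measure \<mu> by (rule finite_borel_measureI) fact+
  have "(cdf \<mu> \<longlongrightarrow> lcdf \<mu> x) (at_left x)" using cdf_at_left by (simp add: lcdf_def)
  show ?thesis
  proof (rule tendstoI)
    fix e :: real assume "e > 0"
    have mono: "mono (lcdf \<mu>)" by (rule lcdf_mono[OF assms])
    have "\<forall>\<^sub>F z in at_left x. dist (cdf \<mu> z) (lcdf \<mu> x) < e"
      by (rule tendstoD) fact+
    then obtain b where b: "b < x" "\<And>z. b < z \<Longrightarrow> z < x \<Longrightarrow> dist (cdf \<mu> z) (lcdf \<mu> x) < e"
      unfolding eventually_at_left_field by auto
    show "\<forall>\<^sub>F z in at_left x. dist (lcdf \<mu> z) (lcdf \<mu> x) < e"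
      unfolding eventually_at_left_field
    proof (intro exI[of _ b] conjI b(1) allI impI)
      fix z assume z: "b < z" "z < x"
      \<comment> \<open>A point strictly between \<open>b\<close> and \<open>z\<close> is required:
        \<open>{..w}\<close> lies in \<open>{..<z}\<close>, while \<open>{..z}\<close> does
        not.\<close>
      define w where "w = (b + z) / 2"
      have w: "b < w" "w < z" using z by (auto simp: w_def)
      have "cdf \<mu> w \<le> lcdf \<mu> z"
        using w by (auto simp: lcdf_def cdf_def intro!: finite_measure_mono)
      moreover have "lcdf \<mu> z \<le> lcdf \<mu> x" using monoD[OF mono, of z x] z by simp
      ultimately show "dist (lcdf \<mu> z) (lcdf \<mu> x) < e"
        using b(2)[of w] w z by (auto simp: dist_real_def)
    qed
  qed
qed

text \<open>Left continuity is automatic. Without an atom at \<open>x\<close>, \<open>lcdf\<close>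
  and \<open>cdf\<close> agree there, and the right continuity of \<open>cdf\<close> supplies the
  other side.\<close>

lemma lcdf_isCont:
  assumes "sets \<mu> = sets borel" and "finite_measure \<mu>" and "measure \<mu> {x} = 0"
  shows "isCont (lcdf \<mu>) x"
proof -
  interpret finite_borel_measure \<mu> by (rule finite_borel_measureI) fact+
  have "measure \<mu> ({..<x} \<union> {x}) = measure \<mu> {..<x} + measure \<mu> {x}"
    using assms by (intro finite_measure_Union) auto
  moreover have "{..<x} \<union> {x} = {..x}" by auto
  ultimately have eq: "cdf \<mu> x = lcdf \<mu> x" using assms(3) by (simp add: lcdf_def cdf_def)
  have "(cdf \<mu> \<longlongrightarrow> lcdf \<mu> x) (at_right x)"
    using cdf_is_right_cont[of x] eq by (simp add: continuous_within)
  hence "(lcdf \<mu> \<longlongrightarrow> lcdf \<mu> x) (at_right x)"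
  proof (rule tendsto_sandwich[OF _ _ tendsto_const, rotated 2])
    show "\<forall>\<^sub>F z in at_right x. lcdf \<mu> x \<le> lcdf \<mu> z"
      using monoD[OF lcdf_mono[OF assms(1,2)], of x]
      by (intro eventually_at_rightI[of x "x + 1"]) auto
    show "\<forall>\<^sub>F z in at_right x. lcdf \<mu> z \<le> cdf \<mu> z"
      by (auto simp: lcdf_def cdf_def intro!: always_eventually finite_measure_mono)
  qed
  thus ?thesis
    using lcdf_tendsto_at_left[OF assms(1,2)] unfolding isCont_def
    by (simp add: filterlim_at_split)
qed

text \<open>Open half-lines are an intersection-stable generator of the Borel sets. This is the
  uniqueness behind \<open>measure_of_lcdf\<close>.\<close>

lemma lcdf_inject:
  assumes "sets \<mu> = sets borel" and "finite_measure \<mu>"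
    and "sets \<nu> = sets borel" and "finite_measure \<nu>" and "lcdf \<mu> = lcdf \<nu>"
  shows "\<mu> = \<nu>"
proof (rule measure_eqI_generator_eq[where E = "range lessThan" and \<Omega> = UNIV and A = "\<lambda>n. {..<real n}"])
  interpret m: finite_measure \<mu> by fact
  interpret n: finite_measure \<nu> by fact
  show "Int_stable (range (lessThan :: real \<Rightarrow> real set))"
  proof (rule Int_stableI, elim imageE)
    fix a b :: real and A B assume "A = {..<a}" "B = {..<b}"
    hence "A \<inter> B = {..<min a b}" by auto
    thus "A \<inter> B \<in> range lessThan" by blast
  qed
  have b: "sets borel = sigma_sets UNIV (range (lessThan :: real \<Rightarrow> real set))"
    by (subst borel_Iio) simp
  show "sets \<mu> = sigma_sets UNIV (range lessThan)" "sets \<nu> = sigma_sets UNIV (range lessThan)"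
    using assms b by auto
  show "emeasure \<mu> X = emeasure \<nu> X" if "X \<in> range lessThan" for X
    using that assms(5) by (auto simp: lcdf_def m.emeasure_eq_measure n.emeasure_eq_measure fun_eq_iff)
  show "(\<Union>i. {..<real i}) = UNIV" by (auto simp: reals_Archimedean2)
qed (use finite_measure.emeasure_finite[OF assms(2)] in auto)

text \<open>\<open>interval_measure\<close> wants a right-continuous function, so the measure is built from
  \<open>x \<mapsto> -F(-x)\<close> and reflected.\<close>
lemma lcdf_measure_of_lcdf:
  assumes mono: "mono F" and left: "\<And>x. (F \<longlongrightarrow> F x) (at_left x)"
    and bot: "(F \<longlongrightarrow> 0) at_bot" and top: "(F \<longlongrightarrow> K) at_top"
  shows "sets (measure_of_lcdf F) = sets borel" and "finite_measure (measure_of_lcdf F)"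
    and "lcdf (measure_of_lcdf F) = F" and "measure (measure_of_lcdf F) UNIV = K"
proof -
  define H where "H = (\<lambda>x. - F (- x))"
  have Hmono: "mono H" using mono by (auto simp: H_def mono_def)
  have Hright: "continuous (at_right x) H" for x
    using tendsto_minus[OF left[of "- x"]]
    unfolding continuous_within unfolding H_def at_right_minus[of x] filterlim_filtermap by simp
  define m where "m = distr (interval_measure H) borel uminus"
  have lims: "(H \<longlongrightarrow> 0) at_top" "(H \<longlongrightarrow> -K) at_bot"
    using tendsto_minus[OF filterlim_compose[OF bot filterlim_uminus_at_bot_at_top]]
      tendsto_minus[OF filterlim_compose[OF top filterlim_uminus_at_top_at_bot]]
    by (simp_all add: H_def)
  have sm: "sets m = sets borel" by (simp add: m_def)
  have Hem: "emeasure (interval_measure H) {a<..b} = ennreal (H b - H a)" if "a \<le> b" for a b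
    using that monoD[OF Hmono] Hright by (intro emeasure_interval_measure_Ioc) auto
  \<comment> \<open>Reflection turns \<open>{..<x}\<close> into an unbounded interval
    \<open>{- x<..}\<close>; its mass is the limit over the bounded intervals on which
    \<open>interval_measure\<close> is known.\<close>
  have lim_emeasure: "emeasure (interval_measure H) {x<..} = ennreal (F (- x))" for x
  proof -
    have "(\<lambda>n. emeasure (interval_measure H) {x<..x + real n}) \<longlonglongrightarrow>
        emeasure (interval_measure H) (\<Union>n. {x<..x + real n})"
      by (intro Lim_emeasure_incseq) (auto simp: incseq_def)
    moreover have "(\<Union>n. {x<..x + real n}) = {x<..}"
    proof -
      have "\<exists>n. z \<le> x + real n" for z using real_arch_simple[of "z - x"] by (auto simp: algebra_simps)
      thus ?thesis by auto
    qed
    moreover have "(\<lambda>n. ennreal (H (x + real n) - H x)) \<longlonglongrightarrow> ennreal (0 - H x)"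
      by (intro tendsto_ennrealI tendsto_diff tendsto_const filterlim_compose[OF lims(1)]
          filterlim_tendsto_add_at_top[OF tendsto_const] filterlim_real_sequentially)
    ultimately have "emeasure (interval_measure H) {x<..} = ennreal (0 - H x)"
      by (intro LIMSEQ_unique) (simp_all add: Hem)
    thus ?thesis by (simp add: H_def)
  qed
  have ems: "emeasure m {..<x} = ennreal (F x)" for x
  proof -
    have "uminus -` {..<x} = {- x<..}" by auto
    thus ?thesis using lim_emeasure[of "- x"] by (simp add: m_def emeasure_distr)
  qed
  have emU: "emeasure m UNIV = ennreal K"
  proof -
    have "(\<lambda>n. emeasure m {..<real n}) \<longlonglongrightarrow> emeasure m (\<Union>n. {..<real n})"
      by (intro Lim_emeasure_incseq) (auto simp: incseq_def sm)
    moreover have "(\<Union>n. {..<real n}) = UNIV" by (auto simp: reals_Archimedean2)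
    moreover have "(\<lambda>n. ennreal (F (real n))) \<longlonglongrightarrow> ennreal K"
      by (intro tendsto_ennrealI filterlim_compose[OF top] filterlim_real_sequentially)
    ultimately show ?thesis by (intro LIMSEQ_unique) (simp_all add: ems)
  qed
  \<comment> \<open>\<open>ennreal\<close> sends negative numbers to \<open>0\<close>, so
    \<open>F\<close> can be read off from \<open>ems\<close> only once it is known to be
    nonnegative.\<close>
  have F0: "0 \<le> F x" for x
  proof (rule tendsto_upperbound[OF bot])
    show "\<forall>\<^sub>F z in at_bot. F z \<le> F x"
      by (rule eventually_mono[OF eventually_le_at_bot[of x]]) (rule monoD[OF mono])
  qed simp
  have K0: "0 \<le> K" by (rule tendsto_lowerbound[OF top]) (auto simp: F0)
  have fm: "finite_measure m"
    by standard (use emU in \<open>simp add: m_def\<close>)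
  have lm: "lcdf m = F" using F0 by (auto simp: lcdf_def measure_def ems)
  have "measure_of_lcdf F = m"
    unfolding measure_of_lcdf_def
  proof (rule the_equality)
    fix \<mu> :: "real measure" assume "sets \<mu> = sets borel \<and> finite_measure \<mu> \<and> lcdf \<mu> = F"
    thus "\<mu> = m" using lcdf_inject sm fm lm by blast
  qed (use sm fm lm in auto)
  thus "sets (measure_of_lcdf F) = sets borel" "finite_measure (measure_of_lcdf F)"
    "lcdf (measure_of_lcdf F) = F" "measure (measure_of_lcdf F) UNIV = K"
    using sm fm lm emU K0 by (auto simp: measure_def)
qed

section \<open>The fundamental theorem of calculus for weak derivatives\<close>

lemma smooth_deriv_affine:
  assumes "smooth f"
  shows "(deriv ^^ n) (\<lambda>x. f (c * (x - a))) = (\<lambda>x. c ^ n * (deriv ^^ n) f (c * (x - a)))"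
proof (induction n)
  case (Suc n)
  have "deriv (\<lambda>x. c ^ n * (deriv ^^ n) f (c * (x - a))) x
      = c ^ Suc n * deriv ((deriv ^^ n) f) (c * (x - a))" for x
  proof (rule DERIV_imp_deriv)
    have "(deriv ^^ n) f differentiable (at (c * (x - a)))"
      using assms by (simp add: smooth_def)
    hence D: "((deriv ^^ n) f has_real_derivative deriv ((deriv ^^ n) f) (c * (x - a))) (at (c * (x - a)))"
      using DERIV_deriv_iff_real_differentiable by blast
    have "((\<lambda>x. c * (x - a)) has_real_derivative c) (at x)"
      by (auto intro!: derivative_eq_intros)
    from DERIV_cmult[OF DERIV_chain2[OF D this], of "c ^ n"]
    show "((\<lambda>x. c ^ n * (deriv ^^ n) f (c * (x - a))) has_real_derivative
        c ^ Suc n * deriv ((deriv ^^ n) f) (c * (x - a))) (at x)"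
      by (simp add: mult_ac)
  qed
  thus ?case by (simp add: Suc.IH fun_eq_iff)
qed simp

lemma smooth_affine:
  assumes "smooth f"
  shows "smooth (\<lambda>x. f (c * (x - a)))"
  unfolding smooth_def smooth_deriv_affine[OF assms]
proof (intro allI)
  fix n x
  have "(deriv ^^ n) f differentiable (at (c * (x - a)))"
    using assms by (simp add: smooth_def)
  hence "(\<lambda>x. (deriv ^^ n) f (c * (x - a))) differentiable (at x)"
    by (intro differentiable_compose[of "(deriv ^^ n) f" "\<lambda>x. c * (x - a)"]) auto
  thus "(\<lambda>x. c ^ n * (deriv ^^ n) f (c * (x - a))) differentiable (at x)"
    by (intro differentiable_mult) auto
qed

lemma smooth_diff:
  assumes "smooth f" and "smooth g"
  shows "smooth (\<lambda>x. f x - g x)"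
proof -
  have d: "(deriv ^^ n) f differentiable (at x)" "(deriv ^^ n) g differentiable (at x)" for n x
    using assms by (auto simp: smooth_def)
  have "(deriv ^^ n) (\<lambda>x. f x - g x) = (\<lambda>x. (deriv ^^ n) f x - (deriv ^^ n) g x)" for n
  proof (induction n)
    case (Suc n)
    have "deriv (\<lambda>x. (deriv ^^ n) f x - (deriv ^^ n) g x) x
        = deriv ((deriv ^^ n) f) x - deriv ((deriv ^^ n) g) x" for x
      using d[of n x]
      by (intro DERIV_imp_deriv DERIV_diff) (auto simp: DERIV_deriv_iff_real_differentiable)
    thus ?case by (simp add: Suc.IH fun_eq_iff)
  qed simp
  thus ?thesis using d by (simp add: smooth_def differentiable_diff)
qed

text \<open>Testing against \<open>\<chi>p(n(x - a)) - \<chi>p(n(x - b))\<close>, a smooth approximation of the indicator of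
  \<open>[a, b]\<close> whose derivative is a difference of two mollifiers, gives the fundamental theorem of
  calculus in the limit \<open>n \<rightarrow> \<infinity>\<close>.\<close>
lemma weak_deriv_integral:
  assumes cut: "cutoff_pair \<chi>p \<chi>m" and weak: "weak_deriv u g"
    and cont: "continuous_on UNIV u" and ab: "a < b"
  shows "u b - u a = (LINT x|lborel. indicator {a..b} x * g x)"
proof -
  have sm: "smooth \<chi>p" and range: "\<And>x. 0 \<le> \<chi>p x \<and> \<chi>p x \<le> 1"
    using cut by (auto simp: cutoff_pair_def)
  have low: "\<chi>p x = 0" if "x \<le> -1" for x
  proof (rule ccontr)
    assume "\<chi>p x \<noteq> 0"
    hence "x \<in> supp \<chi>p" unfolding supp_def by (intro subsetD[OF closure_subset]) simp
    thus False using cut that by (auto simp: cutoff_pair_def)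
  qed
  have high: "\<chi>p x = 1" if "1 \<le> x" for x
  proof -
    have "\<chi>m x = 0"
    proof (rule ccontr)
      assume "\<chi>m x \<noteq> 0"
      hence "x \<in> supp \<chi>m" unfolding supp_def by (intro subsetD[OF closure_subset]) simp
      thus False using cut that by (auto simp: cutoff_pair_def)
    qed
    thus ?thesis using cut by (auto simp: cutoff_pair_def) (metis add.right_neutral)
  qed
  have diff: "\<chi>p differentiable (at x)" "deriv \<chi>p differentiable (at x)" for x
    using sm[unfolded smooth_def, rule_format, of 0 x] sm[unfolded smooth_def, rule_format, of 1 x]
    by auto
  have D: "(\<chi>p has_real_derivative deriv \<chi>p x) (at x)" for x
    using diff by (simp add: DERIV_deriv_iff_real_differentiable)
  have contD: "continuous_on S (deriv \<chi>p)" for S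
    using diff(2) by (intro continuous_at_imp_continuous_on ballI differentiable_imp_continuous_within)
  have D0: "deriv \<chi>p x = 0" if "x < -1 \<or> 1 < x" for x
  proof (rule DERIV_imp_deriv)
    have "\<forall>\<^sub>F z in nhds x. \<chi>p z = (if x < -1 then 0 else 1)"
    proof (cases "x < -1")
      case True
      thus ?thesis using low
        by (auto intro!: eventually_mono[OF eventually_nhds_in_open[of "{..<-1}" x]])
    next
      case False
      thus ?thesis using high that
        by (auto intro!: eventually_mono[OF eventually_nhds_in_open[of "{1<..}" x]])
    qed
    thus "(\<chi>p has_real_derivative 0) (at x)"
      by (subst DERIV_cong_ev[OF refl _ refl]) auto
  qed
  \<comment> \<open>\<open>deriv \<chi>p\<close> acts as a mollifier on \<open>{-1..1}\<close>: its
    mass one is the rise of \<open>\<chi>p\<close> from 0 to 1. The cutoff need not be monotone, so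
    the mollifier may change sign and is dominated by a constant \<open>C\<close> obtained from
    compactness.\<close>
  have D1: "(LINT z|lborel. indicator {-1..1} z * deriv \<chi>p z) = 1"
  proof -
    have "(LINT z|lborel. indicator {-1..1} z *\<^sub>R deriv \<chi>p z) = \<chi>p 1 - \<chi>p (-1)"
      by (rule integral_FTC_atLeastAtMost[OF _ _ contD])
        (use D in \<open>auto simp: has_real_derivative_iff_has_vector_derivative intro: has_vector_derivative_at_within\<close>)
    thus ?thesis using low high by simp
  qed
  obtain C where C: "\<And>z. z \<in> {-1..1} \<Longrightarrow> \<bar>deriv \<chi>p z\<bar> \<le> C"
    using compact_imp_bounded[OF compact_continuous_image[OF contD compact_Icc[of "-1" 1]]]
    unfolding bounded_iff by force
  have um[measurable]: "u \<in> borel_measurable borel" using cont by (rule borel_measurable_continuous_onI)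
  have dm[measurable]: "deriv \<chi>p \<in> borel_measurable borel"
    using contD by (rule borel_measurable_continuous_onI)
  have chim[measurable]: "\<chi>p \<in> borel_measurable borel"
    using diff(1) by (intro borel_measurable_continuous_onI continuous_at_imp_continuous_on ballI
        differentiable_imp_continuous_within)
  have gi: "set_integrable lborel {p..q} g" for p q
    using weak by (auto simp: weak_deriv_def locally_integrable_def)
  have gm[measurable]: "g \<in> borel_measurable borel"
    using weak by (auto simp: weak_deriv_def locally_integrable_def)
  have dom: "integrable lborel (\<lambda>z. K * indicator {-1..1::real} z)" for K :: real
    by (intro integrable_mult_right integrable_real_indicator) (auto simp: emeasure_lborel_Icc_eq)
  have ub: "\<exists>K. \<forall>x\<in>{c-1..c+1}. \<bar>u x\<bar> \<le> K" for c
    using compact_imp_bounded[OF compact_continuous_image[OF continuous_on_subset[OF cont]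
          compact_Icc[of "c - 1" "c + 1"]]]
    unfolding bounded_iff by auto
  define N where "N = (\<lambda>n. real (Suc n))"
  have N: "N n > 0" "N n \<ge> 1" for n by (auto simp: N_def)
  \<comment> \<open>The average of \<open>u\<close> near \<open>c\<close> at scale
    \<open>1 / N n\<close>, written in the rescaled variable \<open>z = N n * (x - c)\<close> so
    that the domain of integration does not depend on \<open>n\<close>.\<close>
  define J where "J = (\<lambda>c n. LINT z|lborel. indicator {-1..1} z * (u (c + z / N n) * deriv \<chi>p z))"
  have bnd: "\<bar>indicator {-1..1} z * (u (c + z / N n) * deriv \<chi>p z)\<bar> \<le> K * C * indicator {-1..1} z"
    if K: "\<forall>x\<in>{c-1..c+1}. \<bar>u x\<bar> \<le> K" for K c n and z :: real
  proof (cases "z \<in> {-1..1}")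
    case True
    have "\<bar>z / N n\<bar> \<le> 1 / 1"
      using True N[of n] by (subst abs_divide, intro frac_le) auto
    hence "c + z / N n \<in> {c-1..c+1}" by (simp only: atLeastAtMost_iff) linarith
    hence "\<bar>u (c + z / N n)\<bar> \<le> K" using K by blast
    hence "\<bar>u (c + z / N n)\<bar> * \<bar>deriv \<chi>p z\<bar> \<le> K * C"
      using C[OF True] abs_ge_zero[of "u (c + z / N n)"] by (intro mult_mono) linarith+
    thus ?thesis using True by (simp add: abs_mult)
  qed auto
  have Jint: "integrable lborel (\<lambda>z. indicator {-1..1} z * (u (c + z / N n) * deriv \<chi>p z))" for c n
  proof -
    obtain K where K: "\<forall>x\<in>{c-1..c+1}. \<bar>u x\<bar> \<le> K" using ub by blast
    show ?thesis
      by (rule Bochner_Integration.integrable_bound[OF dom[of "K * C"]])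
        (use bnd[OF K] in \<open>auto intro!: AE_I2 order_trans[OF _ abs_ge_self]\<close>)
  qed
  have Jlim: "J c \<longlonglongrightarrow> u c" for c
  proof -
    obtain K where K: "\<forall>x\<in>{c-1..c+1}. \<bar>u x\<bar> \<le> K" using ub by blast
    have "J c \<longlonglongrightarrow> (LINT z|lborel. indicator {-1..1} z * (u c * deriv \<chi>p z))"
      unfolding J_def
    proof (rule integral_dominated_convergence[OF _ _ dom[of "K * C"]])
      show "AE z in lborel. (\<lambda>n. indicator {-1..1} z * (u (c + z / N n) * deriv \<chi>p z))
          \<longlonglongrightarrow> indicator {-1..1} z * (u c * deriv \<chi>p z)"
      proof (rule AE_I2)
        fix z :: real
        have "(\<lambda>n. c + z / N n) \<longlonglongrightarrow> c + 0"
          unfolding N_def by (intro tendsto_add tendsto_const real_tendsto_divide_at_top[OF tendsto_const]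
              filterlim_compose[OF filterlim_real_sequentially filterlim_Suc])
        moreover have "isCont u c" using cont by (simp add: continuous_on_eq_continuous_at)
        ultimately have "(\<lambda>n. u (c + z / N n)) \<longlonglongrightarrow> u c"
          using isCont_tendsto_compose[of c u "\<lambda>n. c + z / N n" sequentially] by simp
        thus "(\<lambda>n. indicator {-1..1} z * (u (c + z / N n) * deriv \<chi>p z))
          \<longlonglongrightarrow> indicator {-1..1} z * (u c * deriv \<chi>p z)"
          by (intro tendsto_mult tendsto_const)
      qed
      show "AE z in lborel. norm (indicator {-1..1} z * (u (c + z / N n) * deriv \<chi>p z))
          \<le> K * C * indicator {-1..1} z" for n
        using bnd[OF K] by (intro AE_I2) simp
    qed measurable
    also have "(LINT z|lborel. indicator {-1..1} z * (u c * deriv \<chi>p z))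
        = (LINT z|lborel. u c * (indicator {-1..1} z * deriv \<chi>p z))"
      by (intro Bochner_Integration.integral_cong) auto
    also have "\<dots> = u c" using D1 by simp
    finally show ?thesis .
  qed
  have Jaff: "integrable lborel (\<lambda>x. u x * (N n * deriv \<chi>p (N n * (x - c))))
      \<and> (LINT x|lborel. u x * (N n * deriv \<chi>p (N n * (x - c)))) = J c n" for c n
  proof -
    let ?f = "\<lambda>x. u x * (N n * deriv \<chi>p (N n * (x - c)))"
    have eq: "?f (c + 1 / N n * z) = N n * (indicator {-1..1} z * (u (c + z / N n) * deriv \<chi>p z))" for z
      using N[of n] D0[of z] by (cases "z \<in> {-1..1}") auto
    have "integrable lborel (\<lambda>z. ?f (c + 1 / N n * z))"
      unfolding eq by (intro integrable_mult_right Jint)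
    hence "integrable lborel ?f" using N[of n] by (subst (asm) lborel_integrable_real_affine_iff) auto
    moreover have "(LINT x|lborel. ?f x) = \<bar>1 / N n\<bar> *\<^sub>R (LINT z|lborel. ?f (c + 1 / N n * z))"
      using N[of n] by (intro lborel_integral_real_affine) auto
    ultimately show ?thesis unfolding eq J_def using N[of n] by simp
  qed
  \<comment> \<open>A single rescaled cutoff has unbounded support; in the difference both terms
    equal 1 to the right of \<open>b + 1\<close> and cancel.\<close>
  define \<phi> where "\<phi> = (\<lambda>n x. \<chi>p (N n * (x - a)) - \<chi>p (N n * (x - b)))"
  have phi0: "\<phi> n x = 0" if "x \<notin> {a-1..b+1}" for n x
  proof (cases "x < a - 1")
    case True
    have "N n * (x - a) \<le> N n * (-1)" "N n * (x - b) \<le> N n * (-1)"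
      using N[of n] True ab by (intro mult_left_mono; simp)+
    thus ?thesis using N[of n] by (simp add: \<phi>_def low)
  next
    case False
    have "N n * 1 \<le> N n * (x - a)" "N n * 1 \<le> N n * (x - b)"
      using N[of n] False that ab by (intro mult_left_mono; simp)+
    hence "1 \<le> N n * (x - a)" "1 \<le> N n * (x - b)" using N[of n] by linarith+
    thus ?thesis by (simp add: \<phi>_def high)
  qed
  have "test_function (\<phi> n)" for n
  proof -
    have "supp (\<phi> n) \<subseteq> {a-1..b+1}"
      unfolding supp_def using phi0 by (intro closure_minimal) (blast, simp)
    hence "compact (supp (\<phi> n))"
      unfolding supp_def by (intro compact_eq_bounded_closed[THEN iffD2] conjI bounded_subset[OF bounded_closed_interval]) auto
    thus ?thesis
      unfolding test_function_def \<phi>_def by (auto intro!: smooth_diff smooth_affine sm)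
  qed
  hence "(LINT x|lborel. u x * deriv (\<phi> n) x) = - (LINT x|lborel. g x * \<phi> n x)" for n
    using weak by (simp add: weak_deriv_def)
  moreover have "deriv (\<phi> n) x = N n * deriv \<chi>p (N n * (x - a)) - N n * deriv \<chi>p (N n * (x - b))" for n x
    unfolding \<phi>_def
    by (rule DERIV_imp_deriv) (auto intro!: derivative_eq_intros DERIV_chain2[OF D])
  moreover have "(LINT x|lborel. u x * (N n * deriv \<chi>p (N n * (x - a)) - N n * deriv \<chi>p (N n * (x - b))))
      = J a n - J b n" for n
    unfolding right_diff_distrib[of "u _"]
    by (subst Bochner_Integration.integral_diff) (simp_all only: Jaff[THEN conjunct1] Jaff[THEN conjunct2])
  ultimately have "J a n - J b n = - (LINT x|lborel. g x * \<phi> n x)" for n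
    by (simp only:)
  moreover have "(\<lambda>n. J a n - J b n) \<longlonglongrightarrow> u a - u b" by (intro tendsto_diff Jlim)
  ultimately have l1: "(\<lambda>n. LINT x|lborel. g x * \<phi> n x) \<longlonglongrightarrow> - (u a - u b)"
    using tendsto_minus by fastforce
  have "(\<lambda>n. LINT x|lborel. g x * \<phi> n x) \<longlonglongrightarrow> (LINT x|lborel. indicator {a..b} x * g x)"
  proof (rule integral_dominated_convergence)
    show "integrable lborel (\<lambda>x. \<bar>indicator {a-1..b+1} x * g x\<bar>)"
      using gi[of "a-1" "b+1"] by (intro integrable_abs) (simp add: set_integrable_def)
    show "AE x in lborel. norm (g x * \<phi> n x) \<le> \<bar>indicator {a-1..b+1} x * g x\<bar>" for n
    proof (rule AE_I2)
      fix x
      have "\<bar>\<phi> n x\<bar> \<le> indicator {a-1..b+1} x"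
        using phi0[of x n] range[of "N n * (x - a)"] range[of "N n * (x - b)"]
        by (cases "x \<in> {a-1..b+1}") (auto simp: \<phi>_def)
      hence "\<bar>g x\<bar> * \<bar>\<phi> n x\<bar> \<le> \<bar>g x\<bar> * indicator {a-1..b+1} x" by (intro mult_left_mono) auto
      thus "norm (g x * \<phi> n x) \<le> \<bar>indicator {a-1..b+1} x * g x\<bar>" by (simp add: abs_mult mult.commute)
    qed
    have Ninf: "filterlim N at_top sequentially"
      unfolding N_def by (rule filterlim_compose[OF filterlim_real_sequentially filterlim_Suc])
    have pos: "\<forall>\<^sub>F n in sequentially. \<chi>p (N n * d) = 1" if "0 < d" for d
    proof -
      have "\<forall>\<^sub>F n in sequentially. 1 / d \<le> N n" using Ninf by (simp add: filterlim_at_top)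
      thus ?thesis by eventually_elim (use that high in \<open>simp add: field_simps\<close>)
    qed
    have neg: "\<forall>\<^sub>F n in sequentially. \<chi>p (N n * d) = 0" if "d < 0" for d
    proof -
      have "\<forall>\<^sub>F n in sequentially. 1 / (- d) \<le> N n" using Ninf by (simp add: filterlim_at_top)
      thus ?thesis by eventually_elim (use that low in \<open>simp add: field_simps\<close>)
    qed
    \<comment> \<open>At the endpoints \<open>\<phi> n\<close> involves the unspecified value
      \<open>\<chi>p 0\<close> for every \<open>n\<close>, so pointwise convergence to the indicator
      can fail there.\<close>
    have "AE x in lborel. x \<noteq> a" "AE x in lborel. x \<noteq> b" by (rule AE_lborel_singleton)+
    thus "AE x in lborel. (\<lambda>n. g x * \<phi> n x) \<longlonglongrightarrow> indicator {a..b} x * g x"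
    proof eventually_elim
      case (elim x)
      have "\<forall>\<^sub>F n in sequentially. \<phi> n x = indicator {a..b} x"
      proof -
        consider "x < a" | "a < x" "x < b" | "b < x" using elim by linarith
        thus ?thesis
        proof cases
          case 1
          hence "x - a < 0" "x - b < 0" using ab by auto
          from neg[OF this(1)] neg[OF this(2)] show ?thesis
            by eventually_elim (use 1 ab in \<open>simp add: \<phi>_def\<close>)
        next
          case 2
          hence "0 < x - a" "x - b < 0" using ab by auto
          from pos[OF this(1)] neg[OF this(2)] show ?thesis
            by eventually_elim (use 2 ab in \<open>simp add: \<phi>_def\<close>)
        next
          case 3
          hence "0 < x - a" "0 < x - b" using ab by auto
          from pos[OF this(1)] pos[OF this(2)] show ?thesis
            by eventually_elim (use 3 ab in \<open>simp add: \<phi>_def\<close>)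
        qed
      qed
      hence "\<forall>\<^sub>F n in sequentially. indicator {a..b} x * g x = g x * \<phi> n x"
        by eventually_elim simp
      thus ?case by (rule Lim_transform_eventually[OF tendsto_const])
    qed
  qed (auto simp: \<phi>_def)
  from LIMSEQ_unique[OF l1 this] show ?thesis by simp
qed

text \<open>Cauchy-Schwarz as nonnegativity of a variance: expand the integral of
  \<open>(g x - m)\<^sup>2\<close> with \<open>m\<close> the mean of \<open>g\<close> over the
  interval.\<close>

lemma integral_squared_le:
  fixes g :: "real \<Rightarrow> real"
  assumes g: "set_integrable lborel {a..b} g" and g2: "integrable lborel (\<lambda>x. (g x)\<^sup>2)" and ab: "a < b"
  shows "(LINT x|lborel. indicator {a..b} x * g x)\<^sup>2
    \<le> (b - a) * (LINT x|lborel. indicator {a..b} x * (g x)\<^sup>2)"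
proof -
  let ?I = "LINT x|lborel. indicator {a..b} x * g x"
    and ?E = "LINT x|lborel. indicator {a..b} x * (g x)\<^sup>2"
  define m where "m = ?I / (b - a)"
  have i1: "integrable lborel (\<lambda>x. indicator {a..b} x * g x)"
    using g by (simp add: set_integrable_def)
  have i2: "integrable lborel (\<lambda>x. indicator {a..b} x * (g x)\<^sup>2)"
    using integrable_mult_indicator[OF _ g2, of "{a..b}"] by simp
  have i0: "integrable lborel (indicator {a..b} :: real \<Rightarrow> real)"
    by (intro integrable_real_indicator) (auto simp: emeasure_lborel_Icc_eq)
  have "0 \<le> (LINT x|lborel. indicator {a..b} x * (g x - m)\<^sup>2)"
    by (intro Bochner_Integration.integral_nonneg) auto
  also have "(LINT x|lborel. indicator {a..b} x * (g x - m)\<^sup>2)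
      = (LINT x|lborel. indicator {a..b} x * (g x)\<^sup>2 - 2 * m * (indicator {a..b} x * g x)
          + m\<^sup>2 * indicator {a..b} x)"
    by (intro Bochner_Integration.integral_cong) (auto simp: power2_eq_square algebra_simps)
  also have "\<dots> = ?E - 2 * m * ?I + m\<^sup>2 * (b - a)"
    using i0 i1 i2 ab by simp
  also have "\<dots> = ?E - ?I\<^sup>2 / (b - a)"
  proof -
    have "m * (b - a) = ?I" using ab by (simp add: m_def)
    hence "m\<^sup>2 * (b - a) = m * ?I" by (simp add: power2_eq_square mult.assoc)
    moreover have "m * ?I = ?I\<^sup>2 / (b - a)" by (simp add: m_def power2_eq_square)
    ultimately show ?thesis by simp
  qed
  finally show ?thesis using ab by (simp add: field_simps)
qed

section \<open>Lagrangian solutions\<close>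

lemma continuous_on_holder:
  fixes f :: "real \<Rightarrow> real"
  assumes "\<And>a b. a \<le> b \<Longrightarrow> (f b - f a)\<^sup>2 \<le> (b - a) * K"
  shows "continuous_on UNIV f"
proof -
  have "isCont f a" for a
  proof -
    have "\<bar>f z - f a\<bar> \<le> sqrt (\<bar>z - a\<bar> * K)" for z
      using assms[of a z] assms[of z a] by (intro real_le_rsqrt) (cases "a \<le> z"; simp add: power2_commute)
    moreover have "((\<lambda>z. sqrt (\<bar>z - a\<bar> * K)) \<longlongrightarrow> 0) (at a)"
      by (auto intro!: tendsto_eq_intros)
    ultimately have "((\<lambda>z. f z - f a) \<longlongrightarrow> 0) (at a)"
      by (intro Lim_null_comparison[of "\<lambda>z. f z - f a" "\<lambda>z. sqrt (\<bar>z - a\<bar> * K)"]) auto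
    thus ?thesis unfolding isCont_def by (simp add: LIM_zero_iff)
  qed
  thus ?thesis by (simp add: continuous_on_eq_continuous_at)
qed

text \<open>The discriminant \<open>a\<^sup>2 - b c\<close> of the Lagrangian increments \<open>(b, a, c)\<close> of \<open>(y, U, V)\<close> is
  invariant under the flow.\<close>
lemma discriminant_flow:
  fixes a b c t :: real
  assumes "a\<^sup>2 \<le> b * c" and "0 \<le> b" and "0 \<le> c"
  shows "(a + t * c / 2)\<^sup>2 \<le> (b + t * a + t\<^sup>2 * c / 4) * c" and "0 \<le> b + t * a + t\<^sup>2 * c / 4"
proof -
  show *: "(a + t * c / 2)\<^sup>2 \<le> (b + t * a + t\<^sup>2 * c / 4) * c"
    using assms(1) by (simp add: power2_eq_square algebra_simps)
  show "0 \<le> b + t * a + t\<^sup>2 * c / 4"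
  \<comment> \<open>For \<open>c = 0\<close> the hypothesis forces \<open>a = 0\<close>; otherwise
    the inequality just proved bounds the product with \<open>c\<close> below by a square, and
    \<open>c\<close> is positive.\<close>
  proof (cases "c = 0")
    case True
    thus ?thesis using assms by simp
  next
    case False
    have "0 \<le> (b + t * a + t\<^sup>2 * c / 4) * c"
      using * zero_le_power2[of "a + t * c / 2"] by linarith
    thus ?thesis using False assms(3) by (simp add: zero_le_mult_iff)
  qed
qed

lemma DERIV_within_unique:
  fixes f g :: "real \<Rightarrow> real"
  assumes "\<And>t. 0 \<le> t \<Longrightarrow> (f has_real_derivative d t) (at t within {0..})"
    and "\<And>t. 0 \<le> t \<Longrightarrow> (g has_real_derivative d t) (at t within {0..})"
    and "f 0 = g 0" and "0 \<le> t"
  shows "f t = g t"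
proof -
  have "\<exists>c. \<forall>x\<in>{0..}. f x - g x = c"
    by (rule has_field_derivative_zero_constant) (use DERIV_diff[OF assms(1,2)] in auto)
  then obtain c where c: "\<And>x. x \<in> {0..} \<Longrightarrow> f x - g x = c" by blast
  show ?thesis using c[of 0] c[of t] assms(3,4) by simp
qed

text \<open>In the intended situation \<open>A\<close> is the distribution function of the absolutely continuous
  energy, and the last assumption is the Cauchy-Schwarz inequality for \<open>\<integral>u\<^sub>x\<close>.\<close>
locale energy_pair =
  fixes u A :: "real \<Rightarrow> real" and \<mu> :: "real measure"
  assumes sets_mu: "sets \<mu> = sets borel" and finite_mu: "finite_measure \<mu>"
    and isCont_A: "isCont A x"
    and A_mono: "a \<le> b \<Longrightarrow> A a \<le> A b"
    and A_le: "a \<le> b \<Longrightarrow> A b - A a \<le> lcdf \<mu> b - lcdf \<mu> a"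
    and u_sq_le: "a \<le> b \<Longrightarrow> (u b - u a)\<^sup>2 \<le> (b - a) * (A b - A a)"
begin

abbreviation "F \<equiv> lcdf \<mu>"
abbreviation "K \<equiv> measure \<mu> UNIV"

definition "y0 \<xi> = Sup {x. x + F x < \<xi>}"
text \<open>Obtained by integrating the equations twice: \<open>V\<close> keeps the value
  \<open>\<xi> - y0 \<xi>\<close>, and its limit at infinity is \<open>K\<close>
  (\<open>Lim_V\<close>), so the acceleration is constant in time.\<close>

definition "yt t \<xi> = y0 \<xi> + t * u (y0 \<xi>) + t\<^sup>2 / 2 * ((\<xi> - y0 \<xi>) / 2 - K / 4)"
definition "Ut t \<xi> = u (y0 \<xi>) + t * ((\<xi> - y0 \<xi>) / 2 - K / 4)"

section \<open>Initial characteristics\<close>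

lemmas F_bounds = lcdf_bounds[OF sets_mu finite_mu]

lemma F_mono: "a \<le> b \<Longrightarrow> F a \<le> F b"
  using lcdf_mono[OF sets_mu finite_mu] by (rule monoD)

lemma K_nonneg: "0 \<le> K" by simp

text \<open>Ensures that the \<open>Sup\<close> in \<open>y0\<close> is a genuine supremum; the
  bounds \<open>0 \<le> F \<le> K\<close> locate the set.\<close>

lemma label_set: "{x. x + F x < \<xi>} \<noteq> {}" "bdd_above {x. x + F x < \<xi>}"
proof -
  have "\<xi> - K - 1 \<in> {x. x + F x < \<xi>}" using F_bounds(2)[of "\<xi> - K - 1"] by simp
  thus "{x. x + F x < \<xi>} \<noteq> {}" by blast
  show "bdd_above {x. x + F x < \<xi>}"
  proof (rule bdd_aboveI[of _ \<xi>])
    fix x assume "x \<in> {x. x + F x < \<xi>}"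
    thus "x \<le> \<xi>" using F_bounds(1)[of x] by simp
  qed
qed

lemma y0_lower: "x + F x < \<xi> \<Longrightarrow> x \<le> y0 \<xi>"
  unfolding y0_def using label_set by (intro cSup_upper) auto

lemma y0_greater: "y0 \<xi> < x \<Longrightarrow> \<xi> \<le> x + F x"
  using y0_lower[of x \<xi>] by force

text \<open>Since \<open>x + F x\<close> is strictly increasing, no point to the right of
  \<open>x\<close> is in the set. With \<open>y0_lower\<close>, the side of \<open>x\<close> on
  which \<open>y0 \<xi>\<close> lies is decided by one comparison at \<open>x\<close>;
  \<open>common_cell\<close> uses this at the nodes.\<close>

lemma y0_upper: "\<xi> \<le> x + F x \<Longrightarrow> y0 \<xi> \<le> x"
  unfolding y0_def
proof (rule cSup_least[OF label_set(1)])
  fix z assume "\<xi> \<le> x + F x" "z \<in> {x. x + F x < \<xi>}"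
  thus "z \<le> x" using F_mono[of x z] by (cases "z \<le> x") auto
qed

lemma y0_less: "x < y0 \<xi> \<Longrightarrow> x + F x < \<xi>"
  using y0_upper[of \<xi> x] by force

lemma y0_bounds: "\<xi> - K \<le> y0 \<xi>" "y0 \<xi> \<le> \<xi>"
proof -
  show "\<xi> - K \<le> y0 \<xi>"
  \<comment> \<open>At \<open>\<xi> - K\<close> itself the strict inequality fails when
    \<open>F\<close> has already reached \<open>K\<close>.\<close>
  proof (rule field_le_epsilon)
    fix e :: real assume "0 < e"
    hence "\<xi> - K - e \<le> y0 \<xi>"
      using F_bounds(2)[of "\<xi> - K - e"] by (intro y0_lower) simp
    thus "\<xi> - K \<le> y0 \<xi> + e" by simp
  qed
  show "y0 \<xi> \<le> \<xi>" using F_bounds(1)[of \<xi>] by (intro y0_upper) simp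
qed

text \<open>The strict inequality to the left of \<open>y0 \<xi>\<close> passes to the limit by left
  continuity of \<open>F\<close>. Equality may fail if \<open>\<mu>\<close> has an atom at
  \<open>y0 \<xi>\<close>.\<close>

lemma y0_le: "y0 \<xi> + F (y0 \<xi>) \<le> \<xi>"
proof (rule tendsto_upperbound)
  show "((\<lambda>x. x + F x) \<longlongrightarrow> y0 \<xi> + F (y0 \<xi>)) (at_left (y0 \<xi>))"
    by (intro tendsto_add tendsto_ident_at lcdf_tendsto_at_left sets_mu finite_mu)
  show "\<forall>\<^sub>F x in at_left (y0 \<xi>). x + F x \<le> \<xi>"
    using y0_less by (intro eventually_at_leftI[of "y0 \<xi> - 1"]) (auto intro: less_imp_le)
qed simp

lemma y0_mono: "\<xi>' \<le> \<xi> \<Longrightarrow> y0 \<xi>' \<le> y0 \<xi>"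
  unfolding y0_def by (intro cSup_subset_mono label_set) auto

text \<open>An atom at \<open>y0 \<xi>'\<close> makes a comparison at that point impossible, because
  \<open>y0_le\<close> bounds \<open>\<xi>'\<close> from the wrong side. At points \<open>x\<close>
  just to the right, \<open>y0_greater\<close> gives \<open>\<xi>' \<le> x + F x\<close>; continuity
  of \<open>A\<close> then allows \<open>x\<close> to return to \<open>y0 \<xi>'\<close>.\<close>

lemma energy_increment:
  assumes "\<xi>' \<le> \<xi>"
  shows "A (y0 \<xi>) - A (y0 \<xi>') \<le> (\<xi> - y0 \<xi>) - (\<xi>' - y0 \<xi>')"
proof (cases "y0 \<xi>' = y0 \<xi>")
  case True
  thus ?thesis using assms by simp
next
  case False
  hence less: "y0 \<xi>' < y0 \<xi>" using y0_mono[OF assms] by simp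
  have "y0 \<xi> - y0 \<xi>' + (A (y0 \<xi>) - A (y0 \<xi>')) \<le> \<xi> - \<xi>'"
  proof (rule tendsto_upperbound)
    show "((\<lambda>x. y0 \<xi> - x + (A (y0 \<xi>) - A x)) \<longlongrightarrow> y0 \<xi> - y0 \<xi>' + (A (y0 \<xi>) - A (y0 \<xi>')))
        (at_right (y0 \<xi>'))"
      using isCont_A[of "y0 \<xi>'"]
      by (intro tendsto_intros) (auto simp: isCont_def filterlim_at_split)
    show "\<forall>\<^sub>F x in at_right (y0 \<xi>'). y0 \<xi> - x + (A (y0 \<xi>) - A x) \<le> \<xi> - \<xi>'"
    proof (rule eventually_at_rightI[OF _ less])
      fix x assume x: "x \<in> {y0 \<xi>'<..<y0 \<xi>}"
      thus "y0 \<xi> - x + (A (y0 \<xi>) - A x) \<le> \<xi> - \<xi>'"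
        using y0_greater[of \<xi>' x] y0_le[of \<xi>] A_le[of x "y0 \<xi>"] by simp
    qed
  qed simp
  thus ?thesis by simp
qed

lemma initial_increments:
  assumes "\<xi>' \<le> \<xi>"
  shows "0 \<le> y0 \<xi> - y0 \<xi>'" and "0 \<le> (\<xi> - y0 \<xi>) - (\<xi>' - y0 \<xi>')"
    and "(u (y0 \<xi>) - u (y0 \<xi>'))\<^sup>2 \<le> (y0 \<xi> - y0 \<xi>') * ((\<xi> - y0 \<xi>) - (\<xi>' - y0 \<xi>'))"
proof -
  have m: "y0 \<xi>' \<le> y0 \<xi>" by (rule y0_mono[OF assms])
  thus "0 \<le> y0 \<xi> - y0 \<xi>'" by simp
  show "0 \<le> (\<xi> - y0 \<xi>) - (\<xi>' - y0 \<xi>')"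
    using energy_increment[OF assms] A_mono[OF m] by linarith
  show "(u (y0 \<xi>) - u (y0 \<xi>'))\<^sup>2 \<le> (y0 \<xi> - y0 \<xi>') * ((\<xi> - y0 \<xi>) - (\<xi>' - y0 \<xi>'))"
    using u_sq_le[OF m] mult_left_mono[OF energy_increment[OF assms], of "y0 \<xi> - y0 \<xi>'"] m by linarith
qed

lemma V_bounds: "0 \<le> \<xi> - y0 \<xi>" "\<xi> - y0 \<xi> \<le> K"
  using y0_bounds[of \<xi>] by simp_all

section \<open>Increments along the flow and surjectivity of the characteristics\<close>

lemma increments:
  assumes "\<xi>' \<le> \<xi>"
  shows "(Ut t \<xi> - Ut t \<xi>')\<^sup>2 \<le> (yt t \<xi> - yt t \<xi>') * ((\<xi> - y0 \<xi>) - (\<xi>' - y0 \<xi>'))"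
    and "0 \<le> yt t \<xi> - yt t \<xi>'"
proof -
  have "Ut t \<xi> - Ut t \<xi>' = (u (y0 \<xi>) - u (y0 \<xi>')) + t * ((\<xi> - y0 \<xi>) - (\<xi>' - y0 \<xi>')) / 2"
    "yt t \<xi> - yt t \<xi>' = (y0 \<xi> - y0 \<xi>') + t * (u (y0 \<xi>) - u (y0 \<xi>'))
      + t\<^sup>2 * ((\<xi> - y0 \<xi>) - (\<xi>' - y0 \<xi>')) / 4"
    by (simp_all add: Ut_def yt_def field_simps)
  thus "(Ut t \<xi> - Ut t \<xi>')\<^sup>2 \<le> (yt t \<xi> - yt t \<xi>') * ((\<xi> - y0 \<xi>) - (\<xi>' - y0 \<xi>'))"
    "0 \<le> yt t \<xi> - yt t \<xi>'"
    using discriminant_flow[OF initial_increments(3,1,2)[OF assms], of t] by simp_all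
qed

lemma Ut_sq_le:
  assumes "\<xi>' \<le> \<xi>"
  shows "(Ut t \<xi> - Ut t \<xi>')\<^sup>2 \<le> (yt t \<xi> - yt t \<xi>') * K"
proof -
  have "(\<xi> - y0 \<xi>) - (\<xi>' - y0 \<xi>') \<le> K" using V_bounds[of \<xi>] V_bounds[of \<xi>'] by linarith
  from mult_left_mono[OF this increments(2)[OF assms, of t]] increments(1)[OF assms, of t]
  show ?thesis by linarith
qed

text \<open>Coercivity, as required for surjectivity. By the arithmetic-geometric mean inequality
  the velocity term \<open>t * a\<close> consumes at most half of \<open>b\<close>, up to
  \<open>t\<^sup>2 * K / 2\<close>, and \<open>b\<close> differs from \<open>\<xi> - \<xi>'\<close>
  by at most \<open>K\<close>.\<close>

lemma yt_growth:
  assumes "\<xi>' \<le> \<xi>"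
  shows "(\<xi> - \<xi>' - K - t\<^sup>2 * K) / 2 \<le> yt t \<xi> - yt t \<xi>'"
proof -
  define a b c where "a = u (y0 \<xi>) - u (y0 \<xi>')" and "b = y0 \<xi> - y0 \<xi>'"
    and "c = (\<xi> - y0 \<xi>) - (\<xi>' - y0 \<xi>')"
  have abc: "a\<^sup>2 \<le> b * c" "0 \<le> b" "0 \<le> c"
    using initial_increments[OF assms] by (simp_all add: a_def b_def c_def)
  have cK: "c \<le> K" using V_bounds[of \<xi>] V_bounds[of \<xi>'] by (simp add: c_def)
  have "a\<^sup>2 \<le> b * K" using abc(1) mult_left_mono[OF cK abc(2)] by linarith
  have "\<bar>t * a\<bar> \<le> b / 2 + t\<^sup>2 * K / 2"
  proof (rule power2_le_imp_le)
    have "\<bar>t * a\<bar>\<^sup>2 \<le> t\<^sup>2 * (b * K)"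
      using mult_left_mono[OF \<open>a\<^sup>2 \<le> b * K\<close>, of "t\<^sup>2"] by (simp add: power_mult_distrib)
    also have "\<dots> \<le> (b / 2 + t\<^sup>2 * K / 2)\<^sup>2"
      using zero_le_power2[of "b / 2 - t\<^sup>2 * K / 2"] by (simp add: power2_eq_square algebra_simps)
    finally show "\<bar>t * a\<bar>\<^sup>2 \<le> (b / 2 + t\<^sup>2 * K / 2)\<^sup>2" .
  qed (use abc K_nonneg in simp)
  hence "- (b / 2 + t\<^sup>2 * K / 2) \<le> t * a" by linarith
  moreover have "yt t \<xi> - yt t \<xi>' = b + t * a + t\<^sup>2 * c / 4"
    by (simp add: yt_def a_def b_def c_def field_simps)
  moreover have "0 \<le> t\<^sup>2 * c / 4" using abc by simp
  moreover have "\<xi> - \<xi>' - K \<le> b" using cK by (simp add: b_def c_def)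
  ultimately show ?thesis by (simp add: field_simps)
qed

lemma continuous_u: "continuous_on UNIV u"
proof (rule continuous_on_holder)
  fix a b :: real assume ab: "a \<le> b"
  have "A b - A a \<le> K" using A_le[OF ab] F_bounds(2)[of b] F_bounds(1)[of a] by linarith
  from mult_left_mono[OF this, of "b - a"] u_sq_le[OF ab] ab
  show "(u b - u a)\<^sup>2 \<le> (b - a) * K" by linarith
qed

lemma continuous_y0: "continuous_on UNIV y0"
proof -
  \<comment> \<open>Both \<open>y0\<close> and \<open>\<xi> - y0 \<xi>\<close> are nondecreasing,
    which bounds the slopes of \<open>y0\<close> by 0 and 1.\<close>
  have "1-lipschitz_on UNIV y0"
  proof (rule lipschitz_onI)
    fix x z :: real
    show "dist (y0 x) (y0 z) \<le> 1 * dist x z"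
      using initial_increments(1,2)[of x z] initial_increments(1,2)[of z x]
      by (cases "x \<le> z") (auto simp: dist_real_def)
  qed simp
  thus ?thesis by (rule lipschitz_on_continuous_on)
qed

lemma continuous_u_y0: "continuous_on UNIV (\<lambda>\<xi>. u (y0 \<xi>))"
  using continuous_on_compose2[OF continuous_u continuous_y0] by simp

lemma continuous_yt: "continuous_on UNIV (yt t)" and continuous_Ut: "continuous_on UNIV (Ut t)"
  unfolding yt_def[abs_def] Ut_def[abs_def]
  by (auto intro!: continuous_intros continuous_y0 continuous_u_y0)

lemma yt_surj: obtains \<xi> where "yt t \<xi> = x"
proof -
  \<comment> \<open>Chosen so that \<open>yt_growth\<close> between \<open>0\<close> and
    \<open>R\<close>, or \<open>- R\<close> and \<open>0\<close>, guarantees an increment of at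
    least \<open>\<bar>x - yt t 0\<bar>\<close>.\<close>
  define R where "R = 2 * \<bar>x - yt t 0\<bar> + K + t\<^sup>2 * K"
  have R: "0 \<le> R" using K_nonneg by (simp add: R_def)
  have "yt t (- R) \<le> x" "x \<le> yt t R"
  proof -
    have "(R - K - t\<^sup>2 * K) / 2 = \<bar>x - yt t 0\<bar>" by (simp add: R_def)
    thus "yt t (- R) \<le> x" "x \<le> yt t R"
      using yt_growth[of 0 R t] yt_growth[of "- R" 0 t] R by (simp_all; linarith)+
  qed
  thus ?thesis
    using IVT'[of "yt t" "- R" x R] continuous_on_subset[OF continuous_yt] R that by auto
qed

section \<open>The Eulerian velocity at time t\<close>

definition "ut t x = (THE v. \<exists>\<xi>. x = yt t \<xi> \<and> v = Ut t \<xi>)"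

text \<open>The description is well posed: labels that have met at one position share their
  velocity, because \<open>Ut_sq_le\<close> bounds the squared velocity gap by a multiple of the
  distance.\<close>

lemma ut_yt: "ut t (yt t \<xi>) = Ut t \<xi>"
  unfolding ut_def
proof (rule the_equality)
  fix v assume "\<exists>\<xi>'. yt t \<xi> = yt t \<xi>' \<and> v = Ut t \<xi>'"
  then obtain \<xi>' where eq: "yt t \<xi> = yt t \<xi>'" and v: "v = Ut t \<xi>'" by blast
  have "(Ut t \<xi> - Ut t \<xi>')\<^sup>2 \<le> 0" if "\<xi>' \<le> \<xi>"
    using Ut_sq_le[OF that, of t] unfolding eq by simp
  moreover have "(Ut t \<xi>' - Ut t \<xi>)\<^sup>2 \<le> 0" if "\<xi> \<le> \<xi>'"
    using Ut_sq_le[OF that, of t] unfolding eq by simp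
  ultimately show "v = Ut t \<xi>" unfolding v using linear[of \<xi> \<xi>'] by auto
qed blast

lemma continuous_ut: "continuous_on UNIV (ut t)"
proof (rule continuous_on_holder)
  fix a b :: real assume ab: "a \<le> b"
  obtain \<xi>' where "yt t \<xi>' = a" by (rule yt_surj)
  moreover obtain \<xi> where "yt t \<xi> = b" by (rule yt_surj)
  ultimately have x: "yt t \<xi>' = a" "yt t \<xi> = b" by simp_all
  show "(ut t b - ut t a)\<^sup>2 \<le> (b - a) * K"
  proof (cases "\<xi>' \<le> \<xi>")
    case True
    thus ?thesis using Ut_sq_le[of \<xi>' \<xi> t] ut_yt[of t \<xi>] ut_yt[of t \<xi>'] x by simp
  next
    case False
    \<comment> \<open>The labels come from surjectivity and may be in reverse order; monotonicity of
      \<open>yt t\<close> then collapses the interval.\<close>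
    hence "a = b" using increments(2)[of \<xi> \<xi>' t] ab x by simp
    thus ?thesis by simp
  qed
qed

section \<open>Identification of the solution operator\<close>

lemma Lim_V: "Lim at_top (\<lambda>\<xi>. \<xi> - y0 \<xi>) = K"
proof (rule tendsto_Lim)
  show "((\<lambda>\<xi>. \<xi> - y0 \<xi>) \<longlongrightarrow> K) at_top"
  proof (rule tendsto_sandwich[OF _ _ _ tendsto_const])
    \<comment> \<open>The lower barrier: \<open>y0_le\<close> gives
      \<open>F (y0 \<xi>) \<le> \<xi> - y0 \<xi>\<close>, and \<open>y0 \<xi>\<close> is at least
      \<open>\<xi> - K\<close>.\<close>
    have "((\<lambda>\<xi>. F (- K + \<xi>)) \<longlongrightarrow> K) at_top"
      by (rule filterlim_compose[OF lcdf_tendsto_at_top[OF sets_mu finite_mu]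
            filterlim_tendsto_add_at_top[OF tendsto_const filterlim_ident]])
    thus "((\<lambda>\<xi>. F (- K + \<xi>)) \<longlongrightarrow> K) at_top" .
    show "\<forall>\<^sub>F \<xi> in at_top. F (- K + \<xi>) \<le> \<xi> - y0 \<xi>"
    proof (intro always_eventually allI)
      fix \<xi>
      show "F (- K + \<xi>) \<le> \<xi> - y0 \<xi>"
        using F_mono[of "- K + \<xi>" "y0 \<xi>"] y0_le[of \<xi>] y0_bounds(1)[of \<xi>] by simp
    qed
  qed (use V_bounds in auto)
qed simp

lemma L_map_eq: "L_map (u, \<mu>) = (y0, \<lambda>\<xi>. u (y0 \<xi>), \<lambda>\<xi>. \<xi> - y0 \<xi>)"
  by (simp add: L_map_def Let_def y0_def fun_eq_iff)

text \<open>The system is triangular: \<open>V\<close> is prescribed, which fixes the derivative of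
  \<open>U\<close>, and \<open>U\<close> in turn fixes the derivative of \<open>y\<close>.
  Uniqueness is applied in this order.\<close>

lemma S_op_eq:
  assumes t: "0 \<le> t"
  shows "S_op t (L_map (u, \<mu>)) = (yt t, Ut t, \<lambda>\<xi>. \<xi> - y0 \<xi>)"
  unfolding S_op_def
proof (rule the_equality)
  define V where "V = (\<lambda>\<xi>. \<xi> - y0 \<xi>)"
  let ?X0 = "L_map (u, \<mu>)"
  have dU: "((\<lambda>s. Ut s \<xi>) has_real_derivative 1/2 * V \<xi> - 1/4 * K) (at s within {0..})" for s \<xi>
    unfolding Ut_def by (auto intro!: derivative_eq_intros simp: V_def)
  have dy: "((\<lambda>s. yt s \<xi>) has_real_derivative Ut s \<xi>) (at s within {0..})" for s \<xi>
    unfolding yt_def by (auto intro!: derivative_eq_intros simp: Ut_def)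
  have init: "yt 0 = y0" "Ut 0 = (\<lambda>\<xi>. u (y0 \<xi>))" by (simp_all add: yt_def Ut_def fun_eq_iff)
  have sol: "lagrangian_solution ?X0 yt Ut (\<lambda>_. V)"
    using dU dy init Lim_V by (simp add: lagrangian_solution_def L_map_eq V_def)
  thus "\<exists>y U V'. lagrangian_solution ?X0 y U V' \<and> (yt t, Ut t, \<lambda>\<xi>. \<xi> - y0 \<xi>) = (y t, U t, V' t)"
    unfolding V_def by blast
  fix X assume "\<exists>y U V. lagrangian_solution ?X0 y U V \<and> X = (y t, U t, V t)"
  then obtain y U W where s: "lagrangian_solution ?X0 y U W" and X: "X = (y t, U t, W t)" by blast
  have s': "((\<lambda>s. y s \<xi>) has_real_derivative U s \<xi>) (at s within {0..})"
    "((\<lambda>s. U s \<xi>) has_real_derivative (1/2 * W s \<xi> - 1/4 * Lim at_top (W s))) (at s within {0..})"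
    "W s \<xi> = snd (snd ?X0) \<xi>" if "0 \<le> s" for s \<xi>
    using s that unfolding lagrangian_solution_def by blast+
  have W: "W s = V" if "0 \<le> s" for s
    using s'(3)[OF that] by (simp add: L_map_eq V_def fun_eq_iff)
  have i: "y 0 = y0" "U 0 = (\<lambda>\<xi>. u (y0 \<xi>))"
    using s by (simp_all add: lagrangian_solution_def L_map_eq)
  have dU': "((\<lambda>s. U s \<xi>) has_real_derivative 1/2 * V \<xi> - 1/4 * K) (at s within {0..})" if "0 \<le> s" for s \<xi>
    using s'(2)[OF that, of \<xi>] unfolding W[OF that] Lim_V[folded V_def] .
  have U: "U s \<xi> = Ut s \<xi>" if "0 \<le> s" for s \<xi>
    by (rule DERIV_within_unique[OF dU' dU _ that]) (simp_all add: i init)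
  have dy': "((\<lambda>s. y s \<xi>) has_real_derivative Ut s \<xi>) (at s within {0..})" if "0 \<le> s" for s \<xi>
    using s'(1)[OF that, of \<xi>] unfolding U[OF that] .
  have y: "y s \<xi> = yt s \<xi>" if "0 \<le> s" for s \<xi>
    by (rule DERIV_within_unique[OF dy' dy _ that]) (simp_all add: i init)
  show "X = (yt t, Ut t, \<lambda>\<xi>. \<xi> - y0 \<xi>)"
    unfolding X W[OF t] V_def[symmetric] ext[of "y t", OF y[OF t]] ext[of "U t", OF U[OF t]] ..
qed

lemma fst_T_op:
  assumes "0 \<le> t"
  shows "fst (T_op t (u, \<mu>)) = ut t"
  unfolding T_op_def comp_apply S_op_eq[OF assms] M_map_def prod.case fst_conv ut_def[abs_def] ..

end

section \<open>The projection\<close>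

lemma ac_sing_parts:
  assumes "sets \<mu> = sets borel" and "finite_measure \<mu>"
  shows "sets (ac_part \<mu>) = sets borel" and "finite_measure (ac_part \<mu>)"
    and "sets (sing_part \<mu>) = sets borel" and "finite_measure (sing_part \<mu>)"
    and "\<And>S. S \<in> sets borel \<Longrightarrow> measure \<mu> S = measure (ac_part \<mu>) S + measure (sing_part \<mu>) S"
    and "\<And>S. S \<in> null_sets lborel \<Longrightarrow> emeasure (ac_part \<mu>) S = 0"
proof -
  interpret finite_measure \<mu> by fact
  have d: "lebesgue_decomposition \<mu> (ac_part \<mu>) (sing_part \<mu>)"
    by (rule lebesgue_decomposition_parts[OF assms])
  show s: "sets (ac_part \<mu>) = sets borel" "sets (sing_part \<mu>) = sets borel"
    using d by (simp_all add: lebesgue_decomposition_def)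
  have sp: "space (ac_part \<mu>) = UNIV" "space (sing_part \<mu>) = UNIV"
    using sets_eq_imp_space_eq[OF s(1)] sets_eq_imp_space_eq[OF s(2)] by simp_all
  have e: "emeasure \<mu> S = emeasure (ac_part \<mu>) S + emeasure (sing_part \<mu>) S" if "S \<in> sets borel" for S
    using d that by (simp add: lebesgue_decomposition_def)
  have "emeasure (ac_part \<mu>) UNIV + emeasure (sing_part \<mu>) UNIV \<noteq> \<infinity>"
    using e[of UNIV] emeasure_finite[of UNIV] by simp
  thus fin: "finite_measure (ac_part \<mu>)" "finite_measure (sing_part \<mu>)"
    by (auto intro!: finite_measureI simp: sp)
  show "measure \<mu> S = measure (ac_part \<mu>) S + measure (sing_part \<mu>) S" if "S \<in> sets borel" for S
    using e[OF that] finite_measure.emeasure_finite[OF fin(1), of S] finite_measure.emeasure_finite[OF fin(2), of S]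
    by (simp add: measure_def enn2real_plus less_top)
  show "emeasure (ac_part \<mu>) S = 0" if "S \<in> null_sets lborel" for S
    using d that by (auto simp: lebesgue_decomposition_def absolutely_continuous_def null_sets_def)
qed

lemma Eulerian_energy_pair:
  assumes cut: "cutoff_pair \<chi>p \<chi>m" and Eul: "(u, \<mu>) \<in> Eulerian \<chi>p \<chi>m"
  shows "energy_pair u (lcdf (ac_part \<mu>)) \<mu>"
proof -
  have sm: "sets \<mu> = sets borel" "finite_measure \<mu>" and uE: "u \<in> E2 \<chi>p \<chi>m"
    using Eul by (simp_all add: Eulerian_def)
  define \<nu> where "\<nu> = ac_part \<mu>"
  note parts = ac_sing_parts[OF sm, folded \<nu>_def]
  interpret n: finite_measure \<nu> by (rule parts)
  obtain g where weak: "weak_deriv u g" and dens: "\<nu> = density lborel (\<lambda>x. ennreal ((g x)\<^sup>2))"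
    using Eul by (auto simp: Eulerian_def \<nu>_def)
  have gm[measurable]: "g \<in> borel_measurable borel" and gi: "set_integrable lborel {a..b} g" for a b
    using weak by (auto simp: weak_deriv_def locally_integrable_def)
  have dA: "lcdf \<mu> x = lcdf \<nu> x + lcdf (sing_part \<mu>) x" for x
    unfolding lcdf_def by (intro parts) simp
  have chi: "isCont \<chi>p x" "isCont \<chi>m x" for x
  proof -
    have "(deriv ^^ 0) \<chi>p differentiable (at x)" "(deriv ^^ 0) \<chi>m differentiable (at x)"
      using cut unfolding cutoff_pair_def smooth_def by blast+
    thus "isCont \<chi>p x" "isCont \<chi>m x" by (simp_all add: differentiable_imp_continuous_within)
  qed
  obtain f a b where u: "u = (\<lambda>x. f x + a * \<chi>p x + b * \<chi>m x)" and f: "f \<in> H1_fun"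
    using uE by (auto simp: E2_def)
  have cu: "continuous_on UNIV u"
    using f chi unfolding u H1_fun_def
    by (intro continuous_intros) (auto simp: continuous_on_eq_continuous_at)
  have "(\<integral>\<^sup>+ x. ennreal ((g x)\<^sup>2) \<partial>lborel) = emeasure \<nu> UNIV"
    unfolding dens by (subst emeasure_density) simp_all
  hence "(\<integral>\<^sup>+ x. ennreal ((g x)\<^sup>2) \<partial>lborel) < \<infinity>"
    using n.emeasure_finite[of UNIV] by (simp add: less_top[symmetric])
  \<comment> \<open>Square integrability of the weak derivative is read off from the finite mass of
    \<open>\<nu>\<close>, whose density is \<open>g\<^sup>2\<close>.\<close>
  hence g2: "integrable lborel (\<lambda>x. (g x)\<^sup>2)"
    by (intro integrableI_nonneg) auto
  have null: "measure \<nu> {x} = 0" for x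
    using parts(6)[OF finite_imp_null_set_lborel, of "{x}"] by (simp add: measure_def)
  have "(u b - u a)\<^sup>2 \<le> (b - a) * (lcdf \<nu> b - lcdf \<nu> a)" if "a < b" for a b
  proof -
    have "emeasure \<nu> {a..b} = (\<integral>\<^sup>+ x. ennreal (indicator {a..b} x * (g x)\<^sup>2) \<partial>lborel)"
      unfolding dens by (subst emeasure_density) (auto intro!: nn_integral_cong simp: indicator_def)
    also have "\<dots> = ennreal (LINT x|lborel. indicator {a..b} x * (g x)\<^sup>2)"
      using integrable_mult_indicator[OF _ g2, of "{a..b}"] by (intro nn_integral_eq_integral) auto
    finally have "measure \<nu> {a..b} = (LINT x|lborel. indicator {a..b} x * (g x)\<^sup>2)"
      by (simp add: measure_def Bochner_Integration.integral_nonneg)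
    moreover have "measure \<nu> ({a..<b} \<union> {b}) = measure \<nu> {a..<b} + measure \<nu> {b}"
      by (rule n.finite_measure_Union) (simp_all add: parts)
    moreover have "{a..<b} \<union> {b} = {a..b}" using that by auto
    ultimately have "lcdf \<nu> b - lcdf \<nu> a = (LINT x|lborel. indicator {a..b} x * (g x)\<^sup>2)"
      using that by (simp add: lcdf_diff parts null)
    thus ?thesis
      using integral_squared_le[OF gi g2 that] weak_deriv_integral[OF cut weak cu that] by simp
  qed
  hence sq: "(u b - u a)\<^sup>2 \<le> (b - a) * (lcdf \<nu> b - lcdf \<nu> a)" if "a \<le> b" for a b
    using that by (cases "a = b") auto
  show ?thesis unfolding \<nu>_def[symmetric]
  proof (rule energy_pair.intro)
    fix a b :: real assume ab: "a \<le> b"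
    show "lcdf \<nu> a \<le> lcdf \<nu> b" using lcdf_mono[OF parts(1,2)] ab by (rule monoD)
    show "lcdf \<nu> b - lcdf \<nu> a \<le> lcdf \<mu> b - lcdf \<mu> a"
      using monoD[OF lcdf_mono[OF parts(3,4)] ab] by (simp add: dA)
    show "(u b - u a)\<^sup>2 \<le> (b - a) * (lcdf \<nu> b - lcdf \<nu> a)" by (rule sq[OF ab])
  qed (simp_all add: sm lcdf_isCont parts null)
qed

text \<open>The cross term satisfies \<open>(2 * p * q)\<^sup>2 \<le> 4 * (d * e') * (d' * e) \<le>
  (d * e' + d' * e)\<^sup>2\<close>. This is how Cauchy-Schwarz bounds on adjacent intervals are
  joined.\<close>

lemma square_le_mult_add:
  fixes p q d e d' e' :: real
  assumes "p\<^sup>2 \<le> d * e" and "q\<^sup>2 \<le> d' * e'" and "0 \<le> d" "0 \<le> e" "0 \<le> d'" "0 \<le> e'"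
  shows "(p + q)\<^sup>2 \<le> (d + d') * (e + e')"
proof -
  have "\<bar>2 * p * q\<bar> \<le> d * e' + d' * e"
  proof (rule power2_le_imp_le)
    have "p\<^sup>2 * q\<^sup>2 \<le> (d * e) * (d' * e')" using assms by (intro mult_mono) auto
    moreover have "0 \<le> (d * e' - d' * e)\<^sup>2" by simp
    ultimately show "\<bar>2 * p * q\<bar>\<^sup>2 \<le> (d * e' + d' * e)\<^sup>2"
      by (simp add: power2_eq_square algebra_simps)
  qed (use assms in simp)
  thus ?thesis using assms(1,2) by (simp add: power2_eq_square algebra_simps)
qed

section \<open>The grid\<close>

lemma cell_eq:
  assumes "0 < h" and "node h (2 * j) < x" and "x \<le> node h (2 * j + 2)"
  shows "cell h x = j"
proof -
  have "\<lceil>x / (2 * h)\<rceil> = j + 1"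
    using assms by (intro ceiling_unique) (simp_all add: node_def field_simps)
  thus ?thesis by (simp add: cell_def)
qed

lemma cell_bounds:
  assumes "0 < h"
  shows "node h (2 * cell h x) < x" and "x \<le> node h (2 * cell h x + 2)"
proof -
  define c where "c = \<lceil>x / (2 * h)\<rceil>"
  have "x / (2 * h) \<le> of_int c" "of_int c - 1 < x / (2 * h)"
    unfolding c_def by linarith+
  thus "node h (2 * cell h x) < x" "x \<le> node h (2 * cell h x + 2)"
    using assms unfolding node_def cell_def c_def[symmetric] by (simp_all add: field_simps)
qed

lemma cell_mono:
  assumes "0 < h" and "x \<le> x'"
  shows "cell h x \<le> cell h x'"
  unfolding cell_def using assms by (intro diff_right_mono ceiling_mono divide_right_mono) auto

lemma node_mono: "0 < h \<Longrightarrow> i \<le> j \<Longrightarrow> node h i \<le> node h j"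
  by (simp add: node_def)

locale projection = energy_pair u "lcdf \<nu>" \<mu>
  for u :: "real \<Rightarrow> real" and \<mu> \<nu> :: "real measure" +
  fixes \<sigma> :: "real measure" and s :: "int \<Rightarrow> real" and h :: real
  assumes ac: "sets \<nu> = sets borel" "finite_measure \<nu>"
    and sing: "sets \<sigma> = sets borel" "finite_measure \<sigma>"
    and lcdf_split: "lcdf \<mu> x = lcdf \<nu> x + lcdf \<sigma> x"
    and h: "0 < h"
    and s: "s j = 1 \<or> s j = -1"
begin

abbreviation "A \<equiv> lcdf \<nu>"
abbreviation "B \<equiv> lcdf \<sigma>"
abbreviation "E \<equiv> measure \<nu> UNIV"
abbreviation "x2 j \<equiv> node h (2 * j)"
abbreviation "pu \<equiv> proj_u s h u A"
abbreviation "pA \<equiv> proj_Fac s h u A"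
abbreviation "pB \<equiv> proj_Fsing h B"

text \<open>The slopes of the projected \<open>u\<close> on the left and right halves of a cell;
  their squares are the slopes of \<open>pA\<close>.\<close>

definition "ml j = D_even h u j - s j * q_even h u A j"
definition "mr j = D_even h u j + s j * q_even h u A j"

section \<open>The projection on a single cell\<close>

lemma nodes: "node h (2 * j + 1) = x2 j + h" "node h (2 * j + 2) = x2 j + 2 * h" "x2 (j + 1) = x2 j + 2 * h"
  by (simp_all add: node_def algebra_simps)

lemma s_sq: "s j * s j = 1"
  using s[of j] by auto

text \<open>By \<open>u_sq_le\<close> across the cell the radicand in \<open>q_even\<close> is
  nonnegative, so squaring really undoes the root.\<close>

lemma q_sq: "(q_even h u A j)\<^sup>2 = D_even h A j - (D_even h u j)\<^sup>2"
proof -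
  have "(u (x2 j + 2 * h) - u (x2 j))\<^sup>2 \<le> 2 * h * (A (x2 j + 2 * h) - A (x2 j))"
    using u_sq_le[of "x2 j" "x2 j + 2 * h"] h by simp
  hence "(D_even h u j)\<^sup>2 \<le> D_even h A j"
    using h by (simp add: D_even_def nodes power_divide divide_simps) (simp add: power2_eq_square mult_ac)
  thus ?thesis by (simp add: q_even_def)
qed

lemma D_eqs:
  "2 * h * D_even h u j = u (x2 j + 2 * h) - u (x2 j)"
  "2 * h * D_even h A j = A (x2 j + 2 * h) - A (x2 j)"
  using h by (simp_all add: D_even_def nodes)

lemma A_diff_le: "A b - A a \<le> E"
  using lcdf_bounds[OF ac, of a] lcdf_bounds[OF ac, of b] by linarith

text \<open>By the parallelogram identity the two squared slopes add up to
  \<open>2 * D_even h A j\<close>, the energy of the cell divided by \<open>h\<close>.\<close>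

lemma slopes_sq: "(ml j)\<^sup>2 \<le> E / h" "(mr j)\<^sup>2 \<le> E / h"
proof -
  have "(ml j)\<^sup>2 + (mr j)\<^sup>2 = 2 * (D_even h u j)\<^sup>2 + 2 * (s j * s j) * (q_even h u A j)\<^sup>2"
    by (simp add: ml_def mr_def power2_eq_square algebra_simps)
  hence "(ml j)\<^sup>2 + (mr j)\<^sup>2 = 2 * D_even h A j" unfolding s_sq q_sq by simp
  moreover have "2 * D_even h A j \<le> E / h"
    using D_eqs(2)[of j] A_diff_le[of "x2 j + 2 * h" "x2 j"] h by (simp add: field_simps)
  ultimately show "(ml j)\<^sup>2 \<le> E / h" "(mr j)\<^sup>2 \<le> E / h"
    using zero_le_power2[of "ml j"] zero_le_power2[of "mr j"] by linarith+
qed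

text \<open>The affine branches match at the odd node. The last equation moves the anchor of the
  right branch of \<open>proj_Fac\<close> from the odd node to the right end of the cell, which
  makes the two halves symmetric.\<close>

lemma middle:
  "u (x2 j) + ml j * h = u (x2 j + 2 * h) - mr j * h"
  "A (x2 j) + (ml j)\<^sup>2 * h = A (x2 j + 2 * h) - (mr j)\<^sup>2 * h"
  "1/2 * (A (x2 j + 2 * h) + A (x2 j)) - s j * (2 * q_even h u A j * D_even h u j * h)
    = A (x2 j + 2 * h) - (mr j)\<^sup>2 * h"
proof -
  show "u (x2 j) + ml j * h = u (x2 j + 2 * h) - mr j * h"
    using D_eqs(1)[of j] by (simp add: ml_def mr_def algebra_simps)
  have l: "(ml j)\<^sup>2 = D_even h A j - 2 * s j * q_even h u A j * D_even h u j"
    and r: "(mr j)\<^sup>2 = D_even h A j + 2 * s j * q_even h u A j * D_even h u j"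
  proof -
    have "(s j * q_even h u A j)\<^sup>2 = D_even h A j - (D_even h u j)\<^sup>2"
      unfolding q_sq[symmetric] power_mult_distrib by (simp add: power2_eq_square s_sq)
    thus "(ml j)\<^sup>2 = D_even h A j - 2 * s j * q_even h u A j * D_even h u j"
      "(mr j)\<^sup>2 = D_even h A j + 2 * s j * q_even h u A j * D_even h u j"
      unfolding ml_def mr_def power2_diff power2_sum by (simp_all add: mult_ac)
  qed
  show "A (x2 j) + (ml j)\<^sup>2 * h = A (x2 j + 2 * h) - (mr j)\<^sup>2 * h"
    unfolding l r using D_eqs(2)[of j] by (simp add: algebra_simps)
  show "1/2 * (A (x2 j + 2 * h) + A (x2 j)) - s j * (2 * q_even h u A j * D_even h u j * h)
    = A (x2 j + 2 * h) - (mr j)\<^sup>2 * h"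
    unfolding r using D_eqs(2)[of j] by (simp add: algebra_simps)
qed

lemma proj_interior:
  assumes "x2 j < x" and "x \<le> x2 j + 2 * h"
  shows "pu x = (if x \<le> x2 j + h then u (x2 j) + ml j * (x - x2 j)
      else u (x2 j + 2 * h) + mr j * (x - (x2 j + 2 * h)))"
    and "pA x = (if x \<le> x2 j + h then A (x2 j) + (ml j)\<^sup>2 * (x - x2 j)
      else A (x2 j + 2 * h) + (mr j)\<^sup>2 * (x - (x2 j + 2 * h)))"
    and "pB x = B (x2 j + 2 * h)"
proof -
  have c: "cell h x = j" using assms by (intro cell_eq h) (simp_all add: nodes)
  show "pu x = (if x \<le> x2 j + h then u (x2 j) + ml j * (x - x2 j)
      else u (x2 j + 2 * h) + mr j * (x - (x2 j + 2 * h)))"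
    unfolding proj_u_def c Let_def nodes ml_def mr_def ..
  show "pA x = (if x \<le> x2 j + h then A (x2 j) + (ml j)\<^sup>2 * (x - x2 j)
      else A (x2 j + 2 * h) + (mr j)\<^sup>2 * (x - (x2 j + 2 * h)))"
    unfolding proj_Fac_def c Let_def nodes middle(3) ml_def[symmetric] mr_def[symmetric]
    by (simp add: algebra_simps)
  show "pB x = B (x2 j + 2 * h)" unfolding proj_Fsing_def c nodes ..
qed

lemma proj_node: "pu (x2 j) = u (x2 j)" "pA (x2 j) = A (x2 j)" "pB (x2 j) = B (x2 j)"
proof -
  \<comment> \<open>Cells are open on the left and closed on the right, so \<open>x2 j\<close>
    belongs to the cell with index \<open>j - 1\<close>.\<close>
  have "x2 (j - 1) + 2 * h = x2 j" using nodes(3)[of "j - 1"] by simp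
  thus "pu (x2 j) = u (x2 j)" "pA (x2 j) = A (x2 j)" "pB (x2 j) = B (x2 j)"
    using proj_interior[of "j - 1" "x2 j"] h by auto
qed

lemma proj_left:
  assumes "x2 j \<le> x" and "x \<le> x2 j + h"
  shows "pu x = u (x2 j) + ml j * (x - x2 j)" and "pA x = A (x2 j) + (ml j)\<^sup>2 * (x - x2 j)"
  using assms h proj_node[of j] proj_interior[of j x] by (cases "x = x2 j"; simp)+

lemma proj_right:
  assumes "x2 j + h \<le> x" and "x \<le> x2 j + 2 * h"
  shows "pu x = u (x2 j + 2 * h) + mr j * (x - (x2 j + 2 * h))"
    and "pA x = A (x2 j + 2 * h) + (mr j)\<^sup>2 * (x - (x2 j + 2 * h))"
  using assms h middle(1,2)[of j] proj_interior[of j x]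
  by (cases "x = x2 j + h"; simp add: algebra_simps)+

text \<open>The Cauchy-Schwarz inequality together with a Lipschitz bound; both survive the
  concatenation of adjacent intervals.\<close>
definition "R a b \<longleftrightarrow> (pu b - pu a)\<^sup>2 \<le> (b - a) * (pA b - pA a)
  \<and> 0 \<le> pA b - pA a \<and> pA b - pA a \<le> E / h * (b - a)"

lemma R_trans:
  assumes "R a b" and "R b c" and "a \<le> b" and "b \<le> c"
  shows "R a c"
proof -
  have "((pu b - pu a) + (pu c - pu b))\<^sup>2 \<le> ((b - a) + (c - b)) * ((pA b - pA a) + (pA c - pA b))"
    using assms by (intro square_le_mult_add) (auto simp: R_def)
  moreover have "E / h * (b - a) + E / h * (c - b) = E / h * (c - a)"
    by (simp only: distrib_left[symmetric]) simp
  ultimately show ?thesis using assms(1,2) unfolding R_def by (auto simp del: times_divide_eq_left)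
qed

lemma R_affine:
  assumes "a \<le> b" and "pu b - pu a = m * (b - a)" and "pA b - pA a = m\<^sup>2 * (b - a)" and "m\<^sup>2 \<le> E / h"
  shows "R a b"
  unfolding R_def assms(2,3) using assms(1,4)
  by (intro conjI mult_right_mono) (simp_all add: power2_eq_square)

lemma R_left: "x2 j \<le> a \<Longrightarrow> a \<le> b \<Longrightarrow> b \<le> x2 j + h \<Longrightarrow> R a b"
  using slopes_sq by (intro R_affine[of a b "ml j"]) (auto simp: proj_left[of j] algebra_simps)

lemma R_right: "x2 j + h \<le> a \<Longrightarrow> a \<le> b \<Longrightarrow> b \<le> x2 j + 2 * h \<Longrightarrow> R a b"
  using slopes_sq by (intro R_affine[of a b "mr j"]) (auto simp: proj_right[of j] algebra_simps)

lemma R_cell: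
  assumes "x2 j \<le> a" and "a \<le> b" and "b \<le> x2 j + 2 * h"
  shows "R a b"
proof -
  consider "b \<le> x2 j + h" | "x2 j + h \<le> a" | "a \<le> x2 j + h" "x2 j + h \<le> b" by linarith
  thus ?thesis
  proof cases
    case 3
    hence "R a (x2 j + h)" "R (x2 j + h) b"
      using assms by (auto intro: R_left[of j] R_right[of j])
    thus ?thesis using 3 by (rule R_trans)
  qed (use assms R_left R_right in blast)+
qed

text \<open>The projection agrees with the data at even nodes, so the Cauchy-Schwarz part is
  inherited. \<open>A\<close> itself need not be Lipschitz; the Lipschitz part holds because an
  increment is at most \<open>E\<close> and distinct even nodes are at least \<open>h\<close>
  apart.\<close>

lemma R_nodes:
  assumes "i \<le> j"
  shows "R (x2 i) (x2 j)"
proof -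
  have le: "x2 i \<le> x2 j" using assms h by (intro node_mono) auto
  have "A (x2 j) - A (x2 i) \<le> E / h * (x2 j - x2 i)"
  proof (cases "i = j")
    case False
    hence "h \<le> x2 j - x2 i"
    proof -
      have "1 \<le> real_of_int (j - i)" using assms False by linarith
      hence "1 * h \<le> real_of_int (j - i) * (2 * h)" using h by (intro mult_mono) auto
      thus ?thesis by (simp add: node_def algebra_simps)
    qed
    hence "E / h * h \<le> E / h * (x2 j - x2 i)" using h by (intro mult_left_mono) auto
    thus ?thesis using A_diff_le[of "x2 j" "x2 i"] h by simp
  qed simp
  thus ?thesis using u_sq_le[OF le] A_mono[OF le] unfolding R_def proj_node by simp
qed

text \<open>An interval reaching over several cells splits into a partial cell, a run of full cells
  and another partial cell; \<open>R_trans\<close> joins them.\<close>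

lemma R_all:
  assumes "a \<le> b"
  shows "R a b"
proof -
  define i j where "i = cell h a" and "j = cell h b"
  have a: "x2 i < a" "a \<le> x2 i + 2 * h" and b: "x2 j < b" "b \<le> x2 j + 2 * h"
    using cell_bounds[OF h, of a] cell_bounds[OF h, of b] by (simp_all add: i_def j_def nodes)
  have ij: "i \<le> j" unfolding i_def j_def by (rule cell_mono[OF h assms])
  show ?thesis
  proof (cases "i = j")
    case True
    thus ?thesis using a b assms by (intro R_cell[of i]) auto
  next
    case False
    hence n: "i + 1 \<le> j" using ij by simp
    have le: "x2 (i + 1) \<le> x2 j" using n h by (intro node_mono) auto
    have "R a (x2 (i + 1))" using a by (intro R_cell[of i]) (auto simp: nodes)
    moreover have "R (x2 (i + 1)) (x2 j)" by (rule R_nodes[OF n])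
    ultimately have "R a (x2 j)" by (rule R_trans) (use a le in \<open>simp_all add: nodes\<close>)
    moreover have "R (x2 j) b" using b by (intro R_cell[of j]) auto
    ultimately show ?thesis by (rule R_trans) (use a b le in \<open>simp_all add: nodes\<close>)
  qed
qed

section \<open>The projected distribution function\<close>

lemma pA_mono: "a \<le> b \<Longrightarrow> pA a \<le> pA b"
  using R_all[of a b] by (simp add: R_def)

lemma pB_mono: "a \<le> b \<Longrightarrow> pB a \<le> pB b"
  unfolding proj_Fsing_def
  by (intro monoD[OF lcdf_mono[OF sing]] node_mono h) (use cell_mono[OF h, of a b] in simp)

lemma isCont_pA: "isCont pA x"
proof -
  have "(E / h)-lipschitz_on UNIV pA"
  proof (rule lipschitz_onI)
    fix x z :: real
    show "dist (pA x) (pA z) \<le> E / h * dist x z"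
      using R_all[of x z] R_all[of z x] unfolding R_def dist_real_def
      by (cases "x \<le> z") (auto simp: abs_real_def)
  qed (use h in simp)
  thus ?thesis using lipschitz_on_continuous_on continuous_on_eq_continuous_at by blast
qed

text \<open>Cells contain their right end, so \<open>pB\<close> is constant from the left node of
  the cell of \<open>x\<close> up to \<open>x\<close> itself.\<close>

lemma pB_left: "(pB \<longlongrightarrow> pB x) (at_left x)"
proof (rule Lim_transform_eventually[OF tendsto_const])
  define j where "j = cell h x"
  have x: "x2 j < x" "x \<le> x2 j + 2 * h"
    using cell_bounds[OF h, of x] by (simp_all add: j_def nodes)
  show "\<forall>\<^sub>F z in at_left x. pB x = pB z"
    using x by (intro eventually_at_leftI[OF _ x(1)]) (auto simp: proj_interior(3)[of j])
qed

definition "G x = pA x + pB x"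

lemma G_mono: "mono G"
  by (intro monoI) (simp add: G_def add_mono pA_mono pB_mono)

lemma G_left: "(G \<longlongrightarrow> G x) (at_left x)"
  unfolding G_def[abs_def] using isCont_pA[of x]
  by (intro tendsto_add pB_left) (auto simp: isCont_def filterlim_at_split)

lemma G_node: "G (x2 j) = F (x2 j)"
  by (simp add: G_def proj_node lcdf_split)

text \<open>\<open>G\<close> is monotone and equals \<open>F\<close> at both ends of a cell of width
  \<open>2 * h\<close>. The limits of \<open>F\<close>, and with them the total mass, therefore
  carry over to \<open>G\<close>.\<close>

lemma G_bounds: "F (- (2 * h) + x) \<le> G x" "G x \<le> F (2 * h + x)"
proof -
  define j where "j = cell h x"
  have x: "x2 j < x" "x \<le> x2 (j + 1)" "x2 (j + 1) = x2 j + 2 * h"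
    using cell_bounds[OF h, of x] by (simp_all add: j_def nodes)
  have "F (- (2 * h) + x) \<le> G (x2 j)" unfolding G_node using x by (intro F_mono) simp
  also have "\<dots> \<le> G x" using x by (intro monoD[OF G_mono]) simp
  finally show "F (- (2 * h) + x) \<le> G x" .
  have "G x \<le> G (x2 (j + 1))" using x by (intro monoD[OF G_mono]) simp
  also have "\<dots> \<le> F (2 * h + x)" unfolding G_node using x by (intro F_mono) simp
  finally show "G x \<le> F (2 * h + x)" .
qed

lemma G_top: "(G \<longlongrightarrow> K) at_top"
proof (rule tendsto_sandwich)
  show "((\<lambda>x. F (- (2 * h) + x)) \<longlongrightarrow> K) at_top" "((\<lambda>x. F (2 * h + x)) \<longlongrightarrow> K) at_top"
    by (rule filterlim_compose[OF lcdf_tendsto_at_top[OF sets_mu finite_mu]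
          filterlim_tendsto_add_at_top[OF tendsto_const filterlim_ident]])+
qed (use G_bounds in auto)

lemma G_bot: "(G \<longlongrightarrow> 0) at_bot"
proof (rule tendsto_sandwich)
  have shift: "filterlim (\<lambda>x. c + x) at_bot at_bot" for c :: real
    unfolding filterlim_at_bot
  proof
    fix Z :: real
    show "\<forall>\<^sub>F x in at_bot. c + x \<le> Z"
      by (rule eventually_mono[OF eventually_le_at_bot[of "Z - c"]]) simp
  qed
  show "((\<lambda>x. F (- (2 * h) + x)) \<longlongrightarrow> 0) at_bot" "((\<lambda>x. F (2 * h + x)) \<longlongrightarrow> 0) at_bot"
    by (rule filterlim_compose[OF lcdf_tendsto_at_bot[OF sets_mu finite_mu]
          shift])+
qed (use G_bounds in auto)

abbreviation "p\<mu> \<equiv> measure_of_lcdf G"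

lemmas p\<mu> = lcdf_measure_of_lcdf[OF G_mono G_left G_bot G_top]

text \<open>Gives the projected data the explicit solution, the Hoelder bound and the surjectivity
  proved in \<open>energy_pair\<close>.\<close>

lemma energy_pair_proj: "energy_pair pu pA p\<mu>"
proof (rule energy_pair.intro)
  fix a b :: real assume ab: "a \<le> b"
  show "pA a \<le> pA b" by (rule pA_mono[OF ab])
  show "pA b - pA a \<le> lcdf p\<mu> b - lcdf p\<mu> a"
    unfolding p\<mu>(3) using pB_mono[OF ab] by (simp add: G_def)
  show "(pu b - pu a)\<^sup>2 \<le> (b - a) * (pA b - pA a)" using R_all[OF ab] by (simp add: R_def)
qed (simp_all add: p\<mu> isCont_pA)

section \<open>Distance between u and its projection\<close>

lemma u_diff_le:
  assumes "\<bar>b - a\<bar> \<le> c"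
  shows "\<bar>u b - u a\<bar> \<le> sqrt (E * c)"
proof -
  have *: "(u z - u w)\<^sup>2 \<le> E * c" if "w \<le> z" "z - w \<le> c" for w z
  proof -
    have "(z - w) * (A z - A w) \<le> c * E"
      using that A_diff_le A_mono[OF that(1)] by (intro mult_mono) auto
    thus ?thesis using u_sq_le[OF that(1)] by (simp add: mult.commute)
  qed
  have "(u b - u a)\<^sup>2 \<le> E * c"
    using *[of a b] *[of b a] assms by (cases "a \<le> b") (auto simp: power2_commute[of "u b" "u a"])
  thus ?thesis by (intro real_le_rsqrt) simp
qed

text \<open>Every \<open>x\<close> is within \<open>h\<close> of an even node of its cell, where
  both functions agree. From there \<open>u\<close> moves by at most \<open>sqrt (E * h)\<close> by
  Hoelder continuity, and \<open>pu\<close> by at most the same amount, being affine with slope at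
  most \<open>sqrt (E / h)\<close>.\<close>

lemma pu_diff: "\<bar>u x - pu x\<bar> \<le> 2 * sqrt (E * h)"
proof -
  define j where "j = cell h x"
  have x: "x2 j < x" "x \<le> x2 j + 2 * h"
    using cell_bounds[OF h, of x] by (simp_all add: j_def nodes)
  have slope: "\<bar>m * d\<bar> \<le> sqrt (E * h)" if "m\<^sup>2 \<le> E / h" "\<bar>d\<bar> \<le> h" for m d
  proof (rule real_le_rsqrt)
    have "m\<^sup>2 * d\<^sup>2 \<le> E / h * h\<^sup>2"
      using that h by (intro mult_mono) (auto simp: abs_le_square_iff[symmetric])
    also have "\<dots> = E * h" using h by (simp add: power2_eq_square)
    finally show "\<bar>m * d\<bar>\<^sup>2 \<le> E * h" by (simp add: power_mult_distrib)
  qed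
  show ?thesis
  proof (cases "x \<le> x2 j + h")
    case True
    have "\<bar>u x - u (x2 j)\<bar> \<le> sqrt (E * h)" using True x by (intro u_diff_le) simp
    moreover have "\<bar>ml j * (x - x2 j)\<bar> \<le> sqrt (E * h)"
      using True x by (intro slope slopes_sq) simp
    moreover have "pu x = u (x2 j) + ml j * (x - x2 j)" using True x by (intro proj_left) auto
    ultimately show ?thesis by linarith
  next
    case False
    have "\<bar>u x - u (x2 j + 2 * h)\<bar> \<le> sqrt (E * h)" using False x by (intro u_diff_le) simp
    moreover have "\<bar>mr j * (x - (x2 j + 2 * h))\<bar> \<le> sqrt (E * h)"
      using False x by (intro slope slopes_sq) simp
    moreover have "pu x = u (x2 j + 2 * h) + mr j * (x - (x2 j + 2 * h))"
      using False x by (intro proj_right) auto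
    ultimately show ?thesis by linarith
  qed
qed

end

section \<open>Error estimates\<close>

text \<open>Continuity supplies the measurability that \<open>esssup_I\<close> demands, which is why
  continuity is proved for \<open>yt\<close>, \<open>Ut\<close> and \<open>ut\<close>.\<close>

lemma Linf_norm_le:
  assumes "continuous_on UNIV f" and "\<And>x. \<bar>f x\<bar> \<le> c"
  shows "Linf_norm f \<le> ereal c"
  unfolding Linf_norm_def
proof (rule esssup_I)
  have "f \<in> borel_measurable borel" using assms(1) by (rule borel_measurable_continuous_onI)
  thus "(\<lambda>x. ereal \<bar>f x\<bar>) \<in> borel_measurable lborel" by measurable
qed (use assms(2) in simp)

context projection
begin

interpretation P: energy_pair pu pA p\<mu>
  by (rule energy_pair_proj)

lemma common_cell:
  obtains j where "x2 j \<le> y0 \<xi>" "y0 \<xi> \<le> x2 j + 2 * h" "x2 j \<le> P.y0 \<xi>" "P.y0 \<xi> \<le> x2 j + 2 * h"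
proof -
  have node_F: "lcdf p\<mu> (x2 j) = F (x2 j)" for j by (simp add: p\<mu> G_node)
  have low: "x2 j \<le> y0 \<xi> \<and> x2 j \<le> P.y0 \<xi>" if "x2 j + F (x2 j) < \<xi>" for j
    using that by (simp add: y0_lower P.y0_lower node_F)
  have up: "y0 \<xi> \<le> x2 j \<and> P.y0 \<xi> \<le> x2 j" if "\<not> x2 j + F (x2 j) < \<xi>" for j
    using that by (simp add: y0_upper P.y0_upper node_F)
  define i where "i = cell h (y0 \<xi>)"
  have i: "x2 i < y0 \<xi>" "y0 \<xi> \<le> x2 (i + 1)"
    using cell_bounds[OF h, of "y0 \<xi>"] by (simp_all add: i_def nodes)
  have n: "x2 (j + 1) = x2 j + 2 * h" for j by (simp add: nodes)
  show ?thesis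
  \<comment> \<open>If the comparison still holds at the right end of the cell, then
    \<open>y0 \<xi>\<close> is exactly that node, while the projected characteristic may lie beyond
    it; the common closed cell is then the next one.\<close>
  proof (cases "x2 (i + 1) + F (x2 (i + 1)) < \<xi>")
    case False
    show ?thesis using low[OF y0_less[OF i(1)]] up[OF False] n that[of i] by simp
  next
    case True
    have "y0 \<xi> < x2 (i + 1 + 1)" using i(2) n[of "i + 1"] h by linarith
    hence "\<not> x2 (i + 1 + 1) + F (x2 (i + 1 + 1)) < \<xi>" using y0_greater by (simp add: not_less)
    from low[OF True] up[OF this] show ?thesis using n[of "i + 1"] that[of "i + 1"] by simp
  qed
qed

lemma y0_diff: "\<bar>y0 \<xi> - P.y0 \<xi>\<bar> \<le> 2 * h"
  by (rule common_cell[of \<xi>]) linarith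

text \<open>The value of \<open>u\<close> is first moved from one characteristic to the other and
  then compared with \<open>pu\<close> at the same point. This yields \<open>sqrt 2 + 2\<close>,
  which is \<open>sqrt 2 - 1\<close> below the stated constant.\<close>

lemma u_y0_diff: "\<bar>u (y0 \<xi>) - pu (P.y0 \<xi>)\<bar> \<le> (1 + 2 * sqrt 2) * sqrt (E * h)"
proof -
  have "\<bar>u (y0 \<xi>) - u (P.y0 \<xi>)\<bar> \<le> sqrt (E * (2 * h))"
    using y0_diff by (rule u_diff_le)
  moreover have "sqrt (E * (2 * h)) = sqrt 2 * sqrt (E * h)"
    by (simp add: real_sqrt_mult)
  moreover have "\<bar>u (P.y0 \<xi>) - pu (P.y0 \<xi>)\<bar> \<le> 2 * sqrt (E * h)" by (rule pu_diff)
  moreover have "(1 + 2 * sqrt 2) * sqrt (E * h) - (sqrt 2 * sqrt (E * h) + 2 * sqrt (E * h))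
      = (sqrt 2 - 1) * sqrt (E * h)"
    by (simp add: algebra_simps)
  moreover have "0 \<le> (sqrt 2 - 1) * sqrt (E * h)" using h by simp
  ultimately show ?thesis by linarith
qed

text \<open>Equal total masses cancel the terms with \<open>K / 4\<close>. At a common label the
  difference of \<open>V\<close> is minus that of \<open>y0\<close>, and half of it is at most
  \<open>h\<close>.\<close>

lemma Ut_diff:
  assumes "0 \<le> t"
  shows "\<bar>Ut t \<xi> - P.Ut t \<xi>\<bar> \<le> (1 + 2 * sqrt 2) * sqrt (E * h) + t * h"
proof -
  have "Ut t \<xi> - P.Ut t \<xi> = (u (y0 \<xi>) - pu (P.y0 \<xi>)) - t * ((y0 \<xi> - P.y0 \<xi>) / 2)"
    by (simp add: Ut_def P.Ut_def p\<mu> field_simps)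
  moreover have "\<bar>t * ((y0 \<xi> - P.y0 \<xi>) / 2)\<bar> \<le> t * h"
    using assms mult_left_mono[OF y0_diff[of \<xi>] assms] by (simp add: abs_mult mult_ac)
  ultimately show ?thesis using u_y0_diff[of \<xi>] by linarith
qed

lemma yt_diff:
  assumes "0 \<le> t"
  shows "\<bar>yt t \<xi> - P.yt t \<xi>\<bar> \<le> (1 + 2 * sqrt 2) * sqrt (E * h) * t + (2 + 1/2 * t\<^sup>2) * h"
proof -
  have eq: "yt t \<xi> - P.yt t \<xi> = (y0 \<xi> - P.y0 \<xi>) + t * (u (y0 \<xi>) - pu (P.y0 \<xi>))
      - t\<^sup>2 * ((y0 \<xi> - P.y0 \<xi>) / 4)"
    by (simp add: yt_def P.yt_def p\<mu> field_simps)
  have "\<bar>t * (u (y0 \<xi>) - pu (P.y0 \<xi>))\<bar> \<le> t * ((1 + 2 * sqrt 2) * sqrt (E * h))"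
    using mult_left_mono[OF u_y0_diff assms] assms by (simp add: abs_mult)
  moreover have "\<bar>t\<^sup>2 * ((y0 \<xi> - P.y0 \<xi>) / 4)\<bar> \<le> t\<^sup>2 * (h / 2)"
    using y0_diff[of \<xi>] unfolding abs_mult by (intro mult_mono) auto
  moreover have "(1 + 2 * sqrt 2) * sqrt (E * h) * t + (2 + 1/2 * t\<^sup>2) * h
      = 2 * h + t * ((1 + 2 * sqrt 2) * sqrt (E * h)) + t\<^sup>2 * (h / 2)"
    by (simp add: algebra_simps)
  ultimately show ?thesis unfolding eq using y0_diff[of \<xi>] by linarith
qed

text \<open>At one position \<open>x\<close> the two solutions have different labels
  \<open>\<xi>\<close> and \<open>\<xi>'\<close>. They are compared at the common label
  \<open>\<xi>'\<close>; moving the exact solution from \<open>\<xi>\<close> to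
  \<open>\<xi>'\<close> costs a Hoelder term, and since \<open>yt t \<xi> = P.yt t \<xi>'\<close>,
  the distance moved is the error of \<open>y\<close> at \<open>\<xi>'\<close>.\<close>

lemma ut_diff:
  assumes t: "0 \<le> t"
  shows "\<bar>ut t x - P.ut t x\<bar>
    \<le> sqrt (((1 + 2 * sqrt 2) * sqrt (E * h) * t + (2 + 1/2 * t\<^sup>2) * h) * K)
      + ((1 + 2 * sqrt 2) * sqrt (E * h) + t * h)"
proof -
  let ?d = "(1 + 2 * sqrt 2) * sqrt (E * h) * t + (2 + 1/2 * t\<^sup>2) * h"
  obtain \<xi> where \<xi>: "yt t \<xi> = x" by (rule yt_surj)
  obtain \<xi>' where \<xi>': "P.yt t \<xi>' = x" by (rule P.yt_surj)
  have d: "\<bar>yt t \<xi> - yt t \<xi>'\<bar> \<le> ?d"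
    using yt_diff[OF t, of \<xi>'] unfolding \<xi> \<xi>' by (simp add: abs_minus_commute)
  have "(Ut t \<xi> - Ut t \<xi>')\<^sup>2 \<le> \<bar>yt t \<xi> - yt t \<xi>'\<bar> * K"
  proof (cases "\<xi>' \<le> \<xi>")
    case True
    thus ?thesis using Ut_sq_le[OF True, of t] increments(2)[OF True, of t] by simp
  next
    case False
    hence le: "\<xi> \<le> \<xi>'" by simp
    thus ?thesis
      using Ut_sq_le[OF le, of t] increments(2)[OF le, of t] power2_commute[of "Ut t \<xi>" "Ut t \<xi>'"]
        abs_minus_commute[of "yt t \<xi>" "yt t \<xi>'"] by simp
  qed
  also have "\<dots> \<le> ?d * K" using d by (intro mult_right_mono) auto
  finally have "\<bar>Ut t \<xi> - Ut t \<xi>'\<bar> \<le> sqrt (?d * K)" by (intro real_le_rsqrt) simp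
  moreover have "ut t x = Ut t \<xi>" "P.ut t x = P.Ut t \<xi>'"
    using ut_yt[of t \<xi>] P.ut_yt[of t \<xi>'] \<xi> \<xi>' by simp_all
  ultimately show ?thesis using Ut_diff[OF t, of \<xi>'] by linarith
qed

lemma E_le_K: "E \<le> K"
proof (rule tendsto_le[OF _ lcdf_tendsto_at_top[OF sets_mu finite_mu] lcdf_tendsto_at_top[OF ac]])
  show "\<forall>\<^sub>F x in at_top. A x \<le> F x"
    using lcdf_bounds(1)[OF sing] by (simp add: lcdf_split)
qed simp

text \<open>Enlarging \<open>E\<close> to \<open>K\<close> and subadditivity of the root separate
  the two terms. The exponents 3/4 and 1/4 come from the root of \<open>sqrt K * K\<close> and of
  \<open>sqrt h\<close>.\<close>

lemma ut_diff_powr: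
  assumes t: "0 \<le> t"
  shows "\<bar>ut t x - P.ut t x\<bar>
    \<le> sqrt (1 + 2 * sqrt 2) * K powr (3/4) * t powr (1/2) * h powr (1/4)
      + (1 + 2 * sqrt 2 + sqrt (2 + 1/2 * t\<^sup>2)) * K powr (1/2) * h powr (1/2) + t * h"
proof -
  have c: "0 \<le> 1 + 2 * sqrt 2" by simp
  have q: "x powr (1/4) = sqrt (sqrt x)" if "0 \<le> x" for x :: real
    using that powr_powr[of x "1/2" "1/2"] by (simp add: powr_half_sqrt)
  have q3: "K powr (3/4) = sqrt K * sqrt (sqrt K)"
    using powr_add[of K "1/2" "1/4"] K_nonneg by (simp add: powr_half_sqrt q)
  have EK: "sqrt (E * h) \<le> sqrt K * sqrt h"
    using E_le_K h by (simp add: real_sqrt_mult[symmetric])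
  have "((1 + 2 * sqrt 2) * sqrt (E * h) * t + (2 + 1/2 * t\<^sup>2) * h) * K
      \<le> ((1 + 2 * sqrt 2) * (sqrt K * sqrt h) * t + (2 + 1/2 * t\<^sup>2) * h) * K"
    using EK t c by (intro mult_right_mono add_right_mono mult_left_mono) auto
  hence "sqrt (((1 + 2 * sqrt 2) * sqrt (E * h) * t + (2 + 1/2 * t\<^sup>2) * h) * K)
      \<le> sqrt ((1 + 2 * sqrt 2) * (sqrt K * sqrt h) * t * K + (2 + 1/2 * t\<^sup>2) * h * K)"
    by (simp add: distrib_right)
  also have "\<dots> \<le> sqrt ((1 + 2 * sqrt 2) * (sqrt K * sqrt h) * t * K) + sqrt ((2 + 1/2 * t\<^sup>2) * h * K)"
    using t h by (intro sqrt_add_le_add_sqrt mult_nonneg_nonneg) auto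
  also have "sqrt ((1 + 2 * sqrt 2) * (sqrt K * sqrt h) * t * K)
      = sqrt (1 + 2 * sqrt 2) * K powr (3/4) * t powr (1/2) * h powr (1/4)"
    using t h by (simp add: q q3 powr_half_sqrt real_sqrt_mult)
  also have "sqrt ((2 + 1/2 * t\<^sup>2) * h * K) = sqrt (2 + 1/2 * t\<^sup>2) * K powr (1/2) * h powr (1/2)"
    using h by (simp add: powr_half_sqrt real_sqrt_mult)
  finally have "sqrt (((1 + 2 * sqrt 2) * sqrt (E * h) * t + (2 + 1/2 * t\<^sup>2) * h) * K)
      \<le> sqrt (1 + 2 * sqrt 2) * K powr (3/4) * t powr (1/2) * h powr (1/4)
        + sqrt (2 + 1/2 * t\<^sup>2) * K powr (1/2) * h powr (1/2)" .
  moreover have "(1 + 2 * sqrt 2) * sqrt (E * h) \<le> (1 + 2 * sqrt 2) * K powr (1/2) * h powr (1/2)"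
    using mult_left_mono[OF EK c] h by (simp add: powr_half_sqrt mult.assoc)
  ultimately show ?thesis using ut_diff[OF t, of x] by (simp add: distrib_right)
qed

lemma P_op_eq: "P_op s h (u, \<mu>) = (pu, p\<mu>)" if "\<nu> = ac_part \<mu>" "\<sigma> = sing_part \<mu>"
  by (simp add: P_op_def Let_def that[symmetric] G_def[abs_def])

lemma error_bounds:
  assumes t: "0 \<le> t" and parts: "\<nu> = ac_part \<mu>" "\<sigma> = sing_part \<mu>"
    and L: "(y, U, V) = S_op t (L_map (u, \<mu>))" and L\<Delta>: "(y\<Delta>, U\<Delta>, V\<Delta>) = S_op t (L_map (P_op s h (u, \<mu>)))"
  shows "Linf_norm (\<lambda>\<xi>. U \<xi> - U\<Delta> \<xi>) \<le> ereal ((1 + 2 * sqrt 2) * E powr (1/2) * h powr (1/2) + t * h)"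
    and "Linf_norm (\<lambda>\<xi>. y \<xi> - y\<Delta> \<xi>)
      \<le> ereal ((1 + 2 * sqrt 2) * E powr (1/2) * t * h powr (1/2) + (2 + 1/2 * t\<^sup>2) * h)"
    and "Linf_norm (\<lambda>x. fst (T_op t (u, \<mu>)) x - fst (T_op t (P_op s h (u, \<mu>))) x)
      \<le> ereal (sqrt (1 + 2 * sqrt 2) * K powr (3/4) * t powr (1/2) * h powr (1/4)
        + (1 + 2 * sqrt 2 + sqrt (2 + 1/2 * t\<^sup>2)) * K powr (1/2) * h powr (1/2) + t * h)"
proof -
  have eqs: "y = yt t" "U = Ut t" "y\<Delta> = P.yt t" "U\<Delta> = P.Ut t"
    using L L\<Delta> unfolding P_op_eq[OF parts] S_op_eq[OF t] P.S_op_eq[OF t] by simp_all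
  have root: "sqrt (E * h) = E powr (1/2) * h powr (1/2)"
    using h by (simp add: powr_half_sqrt real_sqrt_mult)
  show "Linf_norm (\<lambda>\<xi>. U \<xi> - U\<Delta> \<xi>) \<le> ereal ((1 + 2 * sqrt 2) * E powr (1/2) * h powr (1/2) + t * h)"
    using Ut_diff[OF t] unfolding eqs root
    by (intro Linf_norm_le continuous_on_diff continuous_Ut P.continuous_Ut) (simp add: mult.assoc)
  show "Linf_norm (\<lambda>\<xi>. y \<xi> - y\<Delta> \<xi>)
      \<le> ereal ((1 + 2 * sqrt 2) * E powr (1/2) * t * h powr (1/2) + (2 + 1/2 * t\<^sup>2) * h)"
    using yt_diff[OF t] unfolding eqs root
    by (intro Linf_norm_le continuous_on_diff continuous_yt P.continuous_yt) (simp add: mult_ac)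
  show "Linf_norm (\<lambda>x. fst (T_op t (u, \<mu>)) x - fst (T_op t (P_op s h (u, \<mu>))) x)
      \<le> ereal (sqrt (1 + 2 * sqrt 2) * K powr (3/4) * t powr (1/2) * h powr (1/4)
        + (1 + 2 * sqrt 2 + sqrt (2 + 1/2 * t\<^sup>2)) * K powr (1/2) * h powr (1/2) + t * h)"
    unfolding P_op_eq[OF parts] fst_T_op[OF t] P.fst_T_op[OF t]
    by (intro Linf_norm_le continuous_on_diff continuous_ut P.continuous_ut ut_diff_powr t)
qed

end

lemma Eulerian_projection:
  assumes "cutoff_pair \<chi>p \<chi>m" and "(u, \<mu>) \<in> Eulerian \<chi>p \<chi>m"
    and "0 < h" and "\<And>j. s j = 1 \<or> s j = -1"
  shows "projection u \<mu> (ac_part \<mu>) (sing_part \<mu>) s h"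
proof (rule projection.intro[OF Eulerian_energy_pair[OF assms(1,2)] projection_axioms.intro])
  have sm: "sets \<mu> = sets borel" "finite_measure \<mu>"
    using assms(2) by (simp_all add: Eulerian_def)
  note parts = ac_sing_parts[OF sm]
  show "lcdf \<mu> x = lcdf (ac_part \<mu>) x + lcdf (sing_part \<mu>) x" for x
    unfolding lcdf_def by (intro parts) simp
qed (use assms ac_sing_parts in \<open>simp_all add: Eulerian_def\<close>)

theorem lemma5p1:
  fixes \<chi>p \<chi>m u0 :: "real \<Rightarrow> real" and \<mu>0 :: "real measure"
    and s :: "int \<Rightarrow> real" and \<Delta>x t :: real
    and y U V y\<Delta> U\<Delta> V\<Delta> u u\<Delta> :: "real \<Rightarrow> real" and \<mu> \<mu>\<Delta> :: "real measure"
  assumes "cutoff_pair \<chi>p \<chi>m"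
    and "(u0, \<mu>0) \<in> Eulerian \<chi>p \<chi>m"
    and "0 < \<Delta>x" and "\<Delta>x \<le> 1"
    and "\<And>j. s j = 1 \<or> s j = -1"
    and "0 \<le> t"
    and "(y, U, V) = (S_op t \<circ> L_map) (u0, \<mu>0)"
    and "(y\<Delta>, U\<Delta>, V\<Delta>) = (S_op t \<circ> L_map \<circ> P_op s \<Delta>x) (u0, \<mu>0)"
    and "(u, \<mu>) = T_op t (u0, \<mu>0)"
    and "(u\<Delta>, \<mu>\<Delta>) = (T_op t \<circ> P_op s \<Delta>x) (u0, \<mu>0)"
  shows "Linf_norm (\<lambda>\<xi>. U \<xi> - U\<Delta> \<xi>)
           \<le> ereal ((1 + 2 * sqrt 2) * measure (ac_part \<mu>0) UNIV powr (1/2) * \<Delta>x powr (1/2)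
                     + t * \<Delta>x) \<and>
         Linf_norm (\<lambda>\<xi>. y \<xi> - y\<Delta> \<xi>)
           \<le> ereal ((1 + 2 * sqrt 2) * measure (ac_part \<mu>0) UNIV powr (1/2) * t * \<Delta>x powr (1/2)
                     + (2 + 1/2 * t\<^sup>2) * \<Delta>x) \<and>
         Linf_norm (\<lambda>x. u x - u\<Delta> x)
           \<le> ereal (sqrt (1 + 2 * sqrt 2) * measure \<mu>0 UNIV powr (3/4) * t powr (1/2)
                       * \<Delta>x powr (1/4)
                     + (1 + 2 * sqrt 2 + sqrt (2 + 1/2 * t\<^sup>2)) * measure \<mu>0 UNIV powr (1/2)
                       * \<Delta>x powr (1/2)
                     + t * \<Delta>x)"
proof -
  interpret projection u0 \<mu>0 "ac_part \<mu>0" "sing_part \<mu>0" s \<Delta>x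
    by (rule Eulerian_projection[OF assms(1-3,5)])
  have "u = fst (T_op t (u0, \<mu>0))" "u\<Delta> = fst (T_op t (P_op s \<Delta>x (u0, \<mu>0)))"
    unfolding assms(9)[symmetric] assms(10)[unfolded comp_apply, symmetric] by simp_all
  thus ?thesis
    using error_bounds[OF assms(6) refl refl assms(7,8)[unfolded comp_apply]] by simp
qed

end
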